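(* Let $g,n,l$ be nonnegative integers with $l\le g$, and let $(d_1,\dots,d_n)$ be a list of nonnegative integers. The quantum correlator $\langle\tau_{d_1}\dots\tau_{d_n}\rangle_{l,g-l}$ vanishes if $$\sum_{j=1}^n d_j>4g-3+n-l\qquad\text{or if}\qquad \sum_{j=1}^n d_j\equiv n-l\pmod 2 .$$
   Context: Throughout $i=\sqrt{-1}$. **Star product.** Let $p_a$ ($a\in\mathbb Z$), $\epsilon,\hbar$ be indeterminates. $\mathcal F^\hbar(P)$ is the space $\mathbb C[p_{a}:a>0][[p_{a}:a\le 0,\ \epsilon]][[\hbar]]$ with the following associative product $\star$. Let $W$ be the algebra generated by the $p_a$ with relations $p_ap_b-p_bp_a=i\hbar a\,\delta_{a+b,0}$. The normal ordering $:f:$ of $f$ is obtained by writing each monomial of $f$ with the $p_a$, $a<0$, on the left and then reading it in $W[[\epsilon,\hbar]]$; $f\star g$ is the unique element with $:f\star g:\;=\;:f:\,:g:$. Put $[f,g]=f\star g-g\star f$. **Differential polynomials.** $\mathcal A=\mathbb C[u_0,u_1,\dots][[\epsilon,\hbar]]$. Via $u_s=\sum_{a\in\mathbb Z}(ia)^sp_ae^{iax}$ it is identified with the algebra $\tilde{\mathcal A}$ of formal Fourier series $\phi(x)=\sum_k\sum_{a_1,\dots,a_k\in\mathbb Z}\phi_k(a_1,\dots,a_k)p_{a_1}\cdots p_{a_k}e^{ix\sum a_j}$ with $\phi_k$ symmetric polynomials in $a_1,\dots,a_k$ with coefficients in $\mathbb C[[\epsilon,\hbar]]$. $\partial_x$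 multiplies the coefficient of $e^{iAx}$ by $iA$ (equivalently $\partial_x=\sum_s u_{s+1}\partial/\partial u_s$); $\overline\phi=\int_{S^1}\phi\,dx$ is the coefficient of $e^{0}$. Commutators $[\phi,\overline\psi]$ are taken Fourier mode by Fourier mode and are again differential polynomials. **Double ramification cycle and Hamiltonians.** For integers $a_1,\dots,a_n$ with sum $0$, $\mathrm{DR}_g(a_1,\dots,a_n)\in H_{2(2g-3+n)}(\overline{\mathcal M}_{g,n})$ is the push-forward, under the map remembering the stabilized source curve, of the virtual fundamental class of the moduli space of rubber stable maps to $(\mathbb P^1,0,\infty)$ from genus $g$ curves with $n$ marked points, where the positive $a_j$ give the ramification profile over $0$, the negatives of the negative $a_j$ give the profile over $\infty$, and the marked points with $a_j=0$ are unconstrained (if all $a_j=0$ this is $(-1)^g\lambda_g$). $\psi_j$ is the first Chern class of the cotangent line at the $j$-th marked point and $\lambda_j$ the $j$-th Chern class of the Hodge bundle. For $d\ge -1$, $$H_d(x)=\sum_{g,m\ge 0,\ 2g+m>0}\frac{(i\hbar)^g}{m!}\sum_{a_1,\dots,a_m\in\mathbb Z}\Big(\int_{\mathrm{DR}_g(0,a_1,\dots,a_m,-\sum a_j)}\psi_1^{d+1}\Lambda\big(\tfrac{-\epsilon^2}{i\hbar}\big)\Big)p_{a_1}\cdots p_{a_m}e^{ix\sum a_j}\in\tilde{\mathcal A},$$ with $\Lambda(s)=1+s\lambda_1+\dots+s^g\lambda_g$, and $\overline H_d=\int_{S^1}H_d\,dx$. (The integral of a tautological class over $\mathrm{DR}_g(a_1,\dots,a_n)$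 is an even polynomial of degree $2g$ in the $a_j$.) One has $[\overline H_{d_1},\overline H_{d_2}]=0$ and $[H_{d_1-1},\overline H_{d_2}]=[H_{d_2-1},\overline H_{d_1}]$. **Two-point functions.** For $d_1,d_2\ge 0$, $\Omega^\hbar_{d_1,d_2}\in\tilde{\mathcal A}$ is defined by $\partial_x\Omega^\hbar_{d_1,d_2}=\frac1\hbar[H_{d_1-1},\overline H_{d_2}]$, the additive constants being fixed by $\Omega^\hbar_{0,d}|_{p_*=0}=\Omega^\hbar_{d,0}|_{p_*=0}=H_{d-1}|_{p_*=0}$ ($d\ge0$) and, for $d_1,d_2\ge 1$, $\frac{\partial\Omega^\hbar_{d_1,d_2}}{\partial p_0}\big|_{p_*=0}=\Omega^\hbar_{d_1-1,d_2}|_{p_*=0}+\Omega^\hbar_{d_1,d_2-1}|_{p_*=0}$. Put $\Omega^{\hbar,\mathbf t}_{d_1,d_2}=\exp\big(\sum_{k\ge0}\frac{t_k}{\hbar}[\,\cdot\,,\overline H_k]\big)\Omega^\hbar_{d_1,d_2}$. **Quantum Witten-Kontsevich series.** There is $\mathcal F\in\mathcal A[[t_0,t_1,\dots]]$ with $\frac{\partial^2\mathcal F}{\partial t_{d_1}\partial t_{d_2}}=\Omega^{\hbar,\mathbf t}_{d_1,d_2}$ for all $d_1,d_2\ge 0$, unique up to terms constant and linear in the $t$'s. $F^{(q)}\in\mathbb C[[\epsilon,\hbar,t_0,t_1,\dots]]$ is obtained by evaluating $\mathcal F$ at $u_s=\delta_{s,1}$, with constant and linear terms in $t$ fixed by: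 for $0\le l\le g$, $d\ge0$, the coefficient of $\epsilon^{2l}\hbar^{g-l}t_d$ equals the coefficient of $\epsilon^{2l}\hbar^{g-l}t_0t_{d+1}$; and the coefficient of $\epsilon^{2l}\hbar^{g-l}$ (no $t$) is $\frac1{2g-2}$ times that of $\epsilon^{2l}\hbar^{g-l}t_1$ if $g\ge2$, and $0$ otherwise. The quantum correlators $\langle\tau_{d_1}\dots\tau_{d_n}\rangle_{l,g-l}$ (symmetric in the $d_j$) are defined by $$F^{(q)}=\sum_{0\le l\le g}\sum_{n\ge0}\sum_{d_1,\dots,d_n\ge0}\frac{\langle\tau_{d_1}\dots\tau_{d_n}\rangle_{l,g-l}}{n!}\epsilon^{2l}(-i\hbar)^{g-l}t_{d_1}\cdots t_{d_n}.$$ *)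

theory Defs
  imports Complex_Main "HOL-Library.Multiset" "HOL-Library.Poly_Mapping"
    "HOL-Library.Groups_Big_Fun" "HOL-Computational_Algebra.Polynomial"
    "HOL-Number_Theory.Cong" "HOL-Combinatorics.Multiset_Permutations"
begin

section \<open>The star product\<close>

text \<open>
  The algebra \<open>W\<close> is the quotient of the free algebra \<open>\<complex>[\<hbar>]\<langle>p_a\<rangle>\<close> by the two-sided ideal generated
  by \<open>p_a p_b - p_b p_a - \<i> \<hbar> a \<delta>_{a+b,0}\<close>.  An element of the free algebra is a finitely
  supported function on words \<open>p_{a_1} \<dots> p_{a_n}\<close> (integer lists) with values in \<open>\<complex>[\<hbar>]\<close>, where
  \<open>\<hbar>\<close> is the polynomial \<open>[:0, 1:]\<close>.
\<close>

inductive_set W_ideal :: "(int list \<Rightarrow>\<^sub>0 complex poly) set" where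
  zero: "0 \<in> W_ideal"
| step: "x \<in> W_ideal \<Longrightarrow>
    x + (Poly_Mapping.single (v @ [a, b] @ w) c - Poly_Mapping.single (v @ [b, a] @ w) c
         - Poly_Mapping.single (v @ w) (if a + b = 0 then [:0, \<i> * of_int a:] * c else 0))
      \<in> W_ideal"

text \<open>
  A monomial in the commuting variables \<open>p_a\<close> is a multiset of integers.  Increasing order puts the
  \<open>p_a\<close> with \<open>a < 0\<close> on the left.
\<close>

definition normal_word :: "int multiset \<Rightarrow> int list" where
  "normal_word M = sorted_list_of_multiset M"

definition normal_ordering :: "(int multiset \<Rightarrow>\<^sub>0 complex poly) \<Rightarrow> (int list \<Rightarrow>\<^sub>0 complex poly)" where
  "normal_ordering h =
     (\<Sum>M \<in> Poly_Mapping.keys h. Poly_Mapping.single (normal_word M) (Poly_Mapping.lookup h M))"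

definition star_monom :: "int multiset \<Rightarrow> int multiset \<Rightarrow> (int multiset \<Rightarrow>\<^sub>0 complex poly)" where
  "star_monom M N =
     (THE h. normal_ordering h - Poly_Mapping.single (normal_word M @ normal_word N) 1 \<in> W_ideal)"

text \<open>
  \<open>f M e r\<close> is the coefficient of \<open>p_M \<epsilon>^e \<hbar>^r\<close>.  The elements of
  \<open>\<complex>[p_a : a > 0][[p_a : a \<le> 0, \<epsilon>]][[\<hbar>]]\<close> are those \<open>f\<close> for which, with \<open>e\<close>, \<open>r\<close> and the part of
  \<open>M\<close> consisting of the \<open>a \<le> 0\<close> fixed, only finitely many coefficients are nonzero.  For such series
  the sum over \<open>(M, N)\<close> below has finite support; it is the bilinear and continuous extension of
  the product of monomials.
\<close>

type_synonym pseries = "int multiset \<Rightarrow> nat \<Rightarrow> nat \<Rightarrow> complex"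

definition star :: "pseries \<Rightarrow> pseries \<Rightarrow> pseries" where
  "star f g = (\<lambda>K e r. \<Sum>e1\<le>e. \<Sum>r1\<le>r. \<Sum>r2\<le>r - r1.
     Sum_any (\<lambda>(M, N). f M e1 r1 * g N (e - e1) r2 *
       coeff (Poly_Mapping.lookup (star_monom M N) K) (r - r1 - r2)))"

definition star_commutator :: "pseries \<Rightarrow> pseries \<Rightarrow> pseries" where
  "star_commutator f g = (\<lambda>K e r. star f g K e r - star g f K e r)"

text \<open>
  Division by \<open>\<hbar>\<close>.  It is only applied to commutators, which have no term of degree \<open>0\<close> in \<open>\<hbar>\<close>.
\<close>

definition div_hbar :: "pseries \<Rightarrow> pseries" where
  "div_hbar f = (\<lambda>M e r. f M e (Suc r))"


section \<open>Differential polynomials and formal Fourier series\<close>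

text \<open>\<open>\<phi> A\<close> is the coefficient of \<open>e^{\<i>Ax}\<close>.\<close>

type_synonym fourier = "int \<Rightarrow> pseries"

definition deriv_x :: "fourier \<Rightarrow> fourier" where
  "deriv_x \<phi> = (\<lambda>A M e r. \<i> * of_int A * \<phi> A M e r)"

definition integral_S1 :: "fourier \<Rightarrow> pseries" where
  "integral_S1 \<phi> = \<phi> 0"

definition fourier_commutator :: "fourier \<Rightarrow> pseries \<Rightarrow> fourier" where
  "fourier_commutator \<phi> h = (\<lambda>A. star_commutator (\<phi> A) h)"

definition fourier_div_hbar :: "fourier \<Rightarrow> fourier" where
  "fourier_div_hbar \<phi> = (\<lambda>A. div_hbar (\<phi> A))"

definition deriv_p0 :: "fourier \<Rightarrow> fourier" where
  "deriv_p0 \<phi> = (\<lambda>A M e r. of_nat (Suc (count M 0)) * \<phi> A (add_mset 0 M) e r)"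

definition at_p_zero :: "fourier \<Rightarrow> int \<Rightarrow> nat \<Rightarrow> nat \<Rightarrow> complex" where
  "at_p_zero \<phi> = (\<lambda>A. \<phi> A {#})"

text \<open>\<open>f U e r\<close> is the coefficient of \<open>(\<Prod>s\<in>#U. u_s) \<epsilon>^e \<hbar>^r\<close>.\<close>

type_synonym useries = "nat multiset \<Rightarrow> nat \<Rightarrow> nat \<Rightarrow> complex"

definition diff_polys :: "useries set" where
  "diff_polys = {f. \<forall>e r. finite {U. f U e r \<noteq> 0}}"

text \<open>
  The coefficient of \<open>p_M e^{\<i>Ax}\<close>, \<open>A = \<Sum>M\<close>, in the expansion of \<open>\<Prod>s\<in>#U. u_s\<close> under
  \<open>u_s = \<Sum>a. (\<i>a)^s p_a e^{\<i>ax}\<close>: the factors are numbered by sorting \<open>U\<close>, and the sum runs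
  over the ways of choosing one \<open>p_a\<close> from each factor with product \<open>p_M\<close>.
\<close>

definition u_monom_coeff :: "nat multiset \<Rightarrow> int multiset \<Rightarrow> complex" where
  "u_monom_coeff U M =
     (if size U = size M then
        \<Sum>as | mset as = M. \<Prod>j<size M. (\<i> * of_int (as ! j)) ^ (sorted_list_of_multiset U ! j)
      else 0)"

definition to_fourier :: "useries \<Rightarrow> fourier" where
  "to_fourier f = (\<lambda>A M e r. if sum_mset M = A
     then \<Sum>U | f U e r \<noteq> 0. f U e r * u_monom_coeff U M else 0)"

definition fourier_diff_polys :: "fourier set" where
  "fourier_diff_polys = to_fourier ` diff_polys"


section \<open>Intersection numbers with the double ramification cycle\<close>

text \<open>
  The cohomological data of the moduli spaces of stable curves.  The type \<open>'h\<close> carries the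
  even-degree real cohomology of all the spaces at once (e.g. the product of the rings
  \<open>H^{2*}(Mbar_{g,n}; \<real>)\<close> over all \<open>(g,n)\<close>), \<open>coh G g n k\<close> being the classes whose component on
  \<open>Mbar_{g,n}\<close> lies in \<open>H^{2k}\<close>.  A homology class is represented by the linear functional
  ``integration over it''; \<open>fund\<close> is the fundamental class of \<open>Mbar_{g,n}\<close>, and \<open>DR G g as\<close> is the
  double ramification cycle \<open>DR_g(a_1,\<dots>,a_n)\<close>, meaningful when the \<open>a_j\<close> sum to \<open>0\<close>.  Marked points
  are numbered from \<open>1\<close>.
\<close>

record 'h moduli_data =
  coh :: "nat \<Rightarrow> nat \<Rightarrow> nat \<Rightarrow> 'h set"
  taut :: "nat \<Rightarrow> nat \<Rightarrow> 'h set"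
  psi :: "nat \<Rightarrow> nat \<Rightarrow> nat \<Rightarrow> 'h"
  lam :: "nat \<Rightarrow> nat \<Rightarrow> nat \<Rightarrow> 'h"
  fund :: "nat \<Rightarrow> nat \<Rightarrow> 'h \<Rightarrow> real"
  DR :: "nat \<Rightarrow> int list \<Rightarrow> 'h \<Rightarrow> real"

text \<open>
  \<open>f\<close> agrees, on integer vectors of length \<open>n\<close> with sum \<open>0\<close>, with a polynomial all of whose
  monomials have even total degree at most \<open>D\<close>.
\<close>

definition even_polynomial_on_sum_zero :: "nat \<Rightarrow> nat \<Rightarrow> (int list \<Rightarrow> real) \<Rightarrow> bool" where
  "even_polynomial_on_sum_zero n D f \<longleftrightarrow>
     (\<exists>c :: nat list \<Rightarrow> real. \<forall>as. length as = n \<and> sum_list as = 0 \<longrightarrow>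
        f as = (\<Sum>es | length es = n \<and> sum_list es \<le> D \<and> even (sum_list es).
                  c es * (\<Prod>j<n. of_int (as ! j) ^ (es ! j))))"

text \<open>
  The construction of the moduli spaces and of the virtual class is not part of HOL, so the geometry
  is a parameter.  The assumptions are: graded multiplicative structure, the degrees of \<open>\<psi>_j\<close>,
  \<open>\<lambda>_j\<close> and of the cycles (\<open>DR_g\<close> lies in \<open>H_{2(2g-3+n)}\<close>), the value \<open>(-1)^g \<lambda>_g\<close> of \<open>DR_g(0,\<dots>,0)\<close>
  under Poincare duality, and even polynomiality of degree \<open>2g\<close> of integrals of tautological classes.
\<close>

locale dr_geometry =
  fixes G :: "'h::{comm_ring_1, real_algebra_1} moduli_data"
  assumes coh_subspace: "2 * g + n > 2 \<Longrightarrow> subspace (coh G g n k)"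
    and coh_one: "2 * g + n > 2 \<Longrightarrow> 1 \<in> coh G g n 0"
    and coh_mult: "2 * g + n > 2 \<Longrightarrow> x \<in> coh G g n k \<Longrightarrow> y \<in> coh G g n k' \<Longrightarrow> x * y \<in> coh G g n (k + k')"
    and taut_subspace: "2 * g + n > 2 \<Longrightarrow> subspace (taut G g n)"
    and taut_one: "2 * g + n > 2 \<Longrightarrow> 1 \<in> taut G g n"
    and taut_mult: "2 * g + n > 2 \<Longrightarrow> x \<in> taut G g n \<Longrightarrow> y \<in> taut G g n \<Longrightarrow> x * y \<in> taut G g n"
    and psi: "2 * g + n > 2 \<Longrightarrow> 1 \<le> j \<Longrightarrow> j \<le> n \<Longrightarrow> psi G g n j \<in> coh G g n 1 \<inter> taut G g n"
    and lam: "2 * g + n > 2 \<Longrightarrow> j \<le> g \<Longrightarrow> lam G g n j \<in> coh G g n j \<inter> taut G g n"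
    and lam_0: "2 * g + n > 2 \<Longrightarrow> lam G g n 0 = 1"
    and fund_linear: "2 * g + n > 2 \<Longrightarrow> linear (fund G g n)"
    and fund_degree: "2 * g + n > 2 \<Longrightarrow> x \<in> coh G g n k \<Longrightarrow> int k \<noteq> 3 * int g - 3 + int n
          \<Longrightarrow> fund G g n x = 0"
    and DR_linear: "2 * g + length as > 2 \<Longrightarrow> sum_list as = 0 \<Longrightarrow> linear (DR G g as)"
    and DR_degree: "2 * g + length as > 2 \<Longrightarrow> sum_list as = 0 \<Longrightarrow> x \<in> coh G g (length as) k
          \<Longrightarrow> int k \<noteq> 2 * int g - 3 + int (length as) \<Longrightarrow> DR G g as x = 0"
    and DR_zero: "2 * g + n > 2 \<Longrightarrow>
          DR G g (replicate n 0) x = fund G g n ((- 1) ^ g * lam G g n g * x)"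
    and DR_even_polynomial: "2 * g + n > 2 \<Longrightarrow> x \<in> taut G g n \<Longrightarrow>
          even_polynomial_on_sum_zero n (2 * g) (\<lambda>as. DR G g as x)"


section \<open>Hamiltonians, two-point functions and the potential\<close>

text \<open>
  \<open>\<integral> \<psi>_1^{d+1} \<lambda>_j\<close> over \<open>DR_g(0, a_1, \<dots>, a_m, -\<Sum>a_j)\<close>, an integral over a cycle in
  \<open>Mbar_{g,m+2}\<close>.
\<close>

definition DR_integral :: "'h::comm_ring_1 moduli_data \<Rightarrow> nat \<Rightarrow> int \<Rightarrow> nat \<Rightarrow> int list \<Rightarrow> real" where
  "DR_integral G g d j as =
     DR G g (0 # as @ [- sum_list as])
       (psi G g (length as + 2) 1 ^ nat (d + 1) * lam G g (length as + 2) j)"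

text \<open>
  \<open>H_d\<close> for \<open>d \<ge> -1\<close>.  The \<open>\<lambda>_j\<close>-term of genus \<open>g\<close> has the prefactor
  \<open>(\<i>\<hbar>)^g (-\<epsilon>^2 / (\<i>\<hbar>))^j = \<i>^g (-1/\<i>)^j \<epsilon>^{2j} \<hbar>^{g-j}\<close> with \<open>0 \<le> j \<le> g\<close>, so it is the only one
  contributing to \<open>\<epsilon>^e \<hbar>^r\<close> for \<open>e = 2j\<close>, \<open>r = g - j\<close>.
\<close>

definition Ham :: "'h::comm_ring_1 moduli_data \<Rightarrow> int \<Rightarrow> fourier" where
  "Ham G d = (\<lambda>A M e r.
     let j = e div 2; g = r + j; m = size M in
     if even e \<and> 2 * g + m > 0 \<and> sum_mset M = A
     then \<i> ^ g * (- 1 / \<i>) ^ j / fact m * (\<Sum>as | mset as = M. of_real (DR_integral G g d j as))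
     else 0)"

definition Ham_bar :: "'h::comm_ring_1 moduli_data \<Rightarrow> int \<Rightarrow> pseries" where
  "Ham_bar G d = integral_S1 (Ham G d)"

definition two_point_functions ::
    "'h::comm_ring_1 moduli_data \<Rightarrow> (nat \<Rightarrow> nat \<Rightarrow> fourier) \<Rightarrow> bool" where
  "two_point_functions G \<Omega> \<longleftrightarrow>
     (\<forall>d1 d2. \<Omega> d1 d2 \<in> fourier_diff_polys) \<and>
     (\<forall>d1 d2. deriv_x (\<Omega> d1 d2) =
        fourier_div_hbar (fourier_commutator (Ham G (int d1 - 1)) (Ham_bar G (int d2)))) \<and>
     (\<forall>d. at_p_zero (\<Omega> 0 d) = at_p_zero (Ham G (int d - 1))) \<and>
     (\<forall>d. at_p_zero (\<Omega> d 0) = at_p_zero (Ham G (int d - 1))) \<and>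
     (\<forall>d1\<ge>1. \<forall>d2\<ge>1. \<forall>A e r. at_p_zero (deriv_p0 (\<Omega> d1 d2)) A e r =
        at_p_zero (\<Omega> (d1 - 1) d2) A e r + at_p_zero (\<Omega> d1 (d2 - 1)) A e r)"

text \<open>
  Power series in \<open>t_0, t_1, \<dots>\<close> are functions of a multiset \<open>T\<close> giving the coefficient of the
  monomial \<open>\<Prod>k\<in>#T. t_k\<close>.  The \<open>n\<close>-th term of the exponential is
  \<open>1/n! \<Sum>k_1,\<dots>,k_n. t_{k_1} \<dots> t_{k_n} D_{k_n} \<dots> D_{k_1}\<close> with \<open>D_k = [\<cdot>, Hbar_k]/\<hbar>\<close>.
\<close>

definition flow :: "'h::comm_ring_1 moduli_data \<Rightarrow> nat \<Rightarrow> fourier \<Rightarrow> fourier" where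
  "flow G k \<phi> = fourier_div_hbar (fourier_commutator \<phi> (Ham_bar G (int k)))"

definition exp_flows :: "'h::comm_ring_1 moduli_data \<Rightarrow> fourier \<Rightarrow> nat multiset \<Rightarrow> fourier" where
  "exp_flows G \<phi> T = (\<lambda>A M e r. (\<Sum>ks | mset ks = T. fold (flow G) ks \<phi> A M e r) / fact (size T))"

definition deriv_t :: "nat \<Rightarrow> (nat multiset \<Rightarrow> useries) \<Rightarrow> nat multiset \<Rightarrow> useries" where
  "deriv_t d F = (\<lambda>T U e r. of_nat (Suc (count T d)) * F (add_mset d T) U e r)"

definition is_potential ::
    "'h::comm_ring_1 moduli_data \<Rightarrow> (nat \<Rightarrow> nat \<Rightarrow> fourier) \<Rightarrow> (nat multiset \<Rightarrow> useries) \<Rightarrow> bool" where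
  "is_potential G \<Omega> F \<longleftrightarrow>
     (\<forall>T. F T \<in> diff_polys) \<and>
     (\<forall>d1 d2 T. to_fourier (deriv_t d1 (deriv_t d2 F) T) = exp_flows G (\<Omega> d1 d2) T)"


section \<open>The quantum Witten-Kontsevich series and its correlators\<close>

definition eval_u :: "useries \<Rightarrow> nat \<Rightarrow> nat \<Rightarrow> complex" where
  "eval_u f = (\<lambda>e r. \<Sum>U | f U e r \<noteq> 0. f U e r * (\<Prod>s\<in>#U. if s = 1 then 1 else 0))"

text \<open>
  \<open>WK_series F T e r\<close> is the coefficient of \<open>(\<Prod>k\<in>#T. t_k) \<epsilon>^e \<hbar>^r\<close>.  Only the terms of \<open>F\<close> of degree
  at least \<open>2\<close> in \<open>t\<close> are used; for \<open>e = 2l\<close> and \<open>r = g - l\<close> the genus is \<open>g = r + e div 2\<close>.  Constant and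
  linear terms in \<open>t\<close> with an odd power of \<open>\<epsilon>\<close> are \<open>0\<close>.
\<close>

definition WK_series :: "(nat multiset \<Rightarrow> useries) \<Rightarrow> nat multiset \<Rightarrow> nat \<Rightarrow> nat \<Rightarrow> complex" where
  "WK_series F T e r =
     (let linear_coeff = (\<lambda>d. if even e then eval_u (F {#0, Suc d#}) e r else 0);
          g = r + e div 2
      in if size T \<ge> 2 then eval_u (F T) e r
         else if size T = 1 then linear_coeff (THE d. T = {#d#})
         else if even e \<and> g \<ge> 2 then linear_coeff 1 / of_nat (2 * g - 2)
         else 0)"

text \<open>\<open>correlator F ds l k\<close> is \<open>\<langle>\<tau>_{d_1} \<dots> \<tau>_{d_n}\<rangle>_{l,k}\<close>.\<close>

definition correlator :: "(nat multiset \<Rightarrow> useries) \<Rightarrow> nat list \<Rightarrow> nat \<Rightarrow> nat \<Rightarrow> complex" where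
  "correlator F ds l k =
     fact (length ds) / of_nat (card {es. mset es = mset ds}) * WK_series F (mset ds) (2 * l) k / (- \<i>) ^ k"

lemma correlator_symmetric:
  "mset ds = mset ds' \<Longrightarrow> correlator F ds l k = correlator F ds' l k"
  by (simp add: correlator_def mset_eq_length[of ds ds'])

text \<open>The expansion of the series in terms of the correlators.\<close>

lemma WK_series_expansion:
  "WK_series F T (2 * l) k =
     (\<Sum>ds | mset ds = T. correlator F ds l k / fact (length ds)) * (- \<i>) ^ k"
proof -
  have ne: "card {es. mset es = T} \<noteq> 0"
    using finite_permutations_of_multiset[of T] permutations_of_multiset_not_empty[of T]
    by (simp add: permutations_of_multiset_def)
  have "(\<Sum>ds | mset ds = T. correlator F ds l k / fact (length ds)) =
        (\<Sum>ds | mset ds = T. WK_series F T (2 * l) k / (- \<i>) ^ k / of_nat (card {es. mset es = T}))"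
    by (intro sum.cong) (auto simp: correlator_def)
  also have "\<dots> = WK_series F T (2 * l) k / (- \<i>) ^ k"
    using ne by simp
  finally show ?thesis by simp
qed

end

theory Submission
  imports Defs "HOL-Computational_Algebra.Fundamental_Theorem_Algebra"
begin

text \<open>
  Each Fourier series in the construction carries three invariants, which are read off the coefficient of
  \<open>p_M \<epsilon>^e \<hbar>^r\<close>: the weight \<open>4r + e + 2|M|\<close> is constant; the reflection \<open>p_a \<mapsto> p_{-a}\<close> multiplies the
  series by a sign; and the coefficient grows at most like the power \<open>2r + e + c\<close> of the indices in \<open>M\<close>.
  For \<open>H_d\<close> the weight comes from the dimension of the DR cycle, and sign and growth come from the even
  polynomiality.  A contraction of \<open>k\<close> pairs in a star commutator is a sum over \<open>k - 1\<close> free indices of a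
  product of \<open>k\<close> indices, which contributes \<open>2k - 1\<close> to the growth; since the reflection reverses products,
  the sign flips.  Hence each flow raises \<open>c\<close> by one, flips the sign and shifts the weight by \<open>2d\<close>.
  For differential polynomials the sign and the growth determine the parity and bound the size of the
  differential degree.  At \<open>u_s = \<delta>_{s,1}\<close> only the monomials \<open>u_1^m\<close> survive, whose differential degree is
  \<open>m\<close>; the weight expresses \<open>m\<close> through \<open>g\<close>, \<open>l\<close> and the \<open>d_j\<close>, and the two vanishing conditions are the
  degree bound and the parity.
\<close>

section \<open>Normal ordering\<close>

text \<open>Polynomiality of the intermediate objects is never established. A single product in a
  star commutator sums over positive contracted indices with prescribed total, and in general its
  coefficients are only piecewise polynomial. Growth is an estimate at integer points, so it passes
  through each product separately; evenness is replaced by the reflection, an anti-automorphism of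
  the star product. Both become statements about monomials only where a series is known to be a
  differential polynomial: for the two-point functions and for the coefficients of the potential.
  The index saved in each commutator is due to the second factor being a zero mode, which fixes the
  sum of the contracted indices. The additive constants of the two-point functions are invisible to
  the x-derivative and need a recursion of their own. Since the star product of monomials is a
  definite description, everything rests on existence and uniqueness of normal forms.\<close>

definition linext :: "('k \<Rightarrow> 'c \<Rightarrow> 'b) \<Rightarrow> ('k \<Rightarrow>\<^sub>0 'c::zero) \<Rightarrow> 'b::comm_monoid_add" where
  "linext F h = (\<Sum>k \<in> Poly_Mapping.keys h. F k (Poly_Mapping.lookup h k))"

lemma linext_superset:
  assumes "\<And>k. F k 0 = 0" and "finite S" and "Poly_Mapping.keys h \<subseteq> S"
  shows "linext F h = (\<Sum>k\<in>S. F k (Poly_Mapping.lookup h k))"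
  unfolding linext_def by (rule sum.mono_neutral_left) (use assms in \<open>auto simp: in_keys_iff\<close>)

lemma linext_single:
  assumes "F k 0 = 0"
  shows "linext F (Poly_Mapping.single k c) = F k c"
  using assms by (cases "c = 0") (simp_all add: linext_def)

lemma additive_linext:
  fixes F :: "'k \<Rightarrow> 'c::ab_group_add \<Rightarrow> 'b::ab_group_add"
  assumes "\<And>k. additive (F k)"
  shows "additive (linext F)"
proof
  fix g h :: "'k \<Rightarrow>\<^sub>0 'c"
  interpret additive "F k" for k by fact
  let ?S = "Poly_Mapping.keys g \<union> Poly_Mapping.keys h"
  have "linext F (g + h) = (\<Sum>k\<in>?S. F k (Poly_Mapping.lookup (g + h) k))"
    by (rule linext_superset) (auto simp: zero Poly_Mapping.keys_add)
  moreover have "linext F g = (\<Sum>k\<in>?S. F k (Poly_Mapping.lookup g k))"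
    by (rule linext_superset) (auto simp: zero)
  moreover have "linext F h = (\<Sum>k\<in>?S. F k (Poly_Mapping.lookup h k))"
    by (rule linext_superset) (auto simp: zero)
  ultimately show "linext F (g + h) = linext F g + linext F h"
    by (simp add: lookup_add add sum.distrib)
qed

lemma additive_single: "additive (Poly_Mapping.single k)"
  by standard (rule single_add)

lemma normal_ordering_linext:
  "normal_ordering = linext (\<lambda>M. Poly_Mapping.single (normal_word M))"
  by (simp add: fun_eq_iff normal_ordering_def linext_def)

lemma additive_normal_ordering: "additive normal_ordering"
  unfolding normal_ordering_linext by (intro additive_linext additive_single)

lemma normal_ordering_single:
  "normal_ordering (Poly_Mapping.single M c) = Poly_Mapping.single (normal_word M) c"
  unfolding normal_ordering_linext by (simp add: linext_single)

section \<open>The ideal of relations and the functionals vanishing on it\<close>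

lemma W_ideal_add: "x \<in> W_ideal \<Longrightarrow> y \<in> W_ideal \<Longrightarrow> x + y \<in> W_ideal"
proof (rotate_tac, induction y rule: W_ideal.induct)
  case (step y v a b w c)
  from W_ideal.step[OF step.IH[OF step.prems], of v a b w c] show ?case
    by (simp add: algebra_simps)
qed simp

lemma W_ideal_relation:
  "Poly_Mapping.single (v @ [a, b] @ w) c - Poly_Mapping.single (v @ [b, a] @ w) c
     - Poly_Mapping.single (v @ w) (if a + b = 0 then [:0, \<i> * of_int a:] * c else 0) \<in> W_ideal"
  using W_ideal.step[OF W_ideal.zero, of v a b w c] by simp

lemma W_ideal_uminus: "x \<in> W_ideal \<Longrightarrow> - x \<in> W_ideal"
proof (induction x rule: W_ideal.induct)
  case (step y v a b w c)
  let ?rel = "\<lambda>c. Poly_Mapping.single (v @ [a, b] @ w) c - Poly_Mapping.single (v @ [b, a] @ w) c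
     - Poly_Mapping.single (v @ w) (if a + b = 0 then [:0, \<i> * of_int a:] * c else 0)"
  have "?rel (- c) = - ?rel c"
    by (cases "a + b = 0") (simp_all add: single_uminus del: mult_pCons_left)
  with W_ideal.step[OF step.IH, of v a b w "-c"] show ?case
    by (simp only: minus_add_distrib)
qed (simp add: W_ideal.zero)

lemma W_ideal_diff: "x \<in> W_ideal \<Longrightarrow> y \<in> W_ideal \<Longrightarrow> x - y \<in> W_ideal"
  using W_ideal_add[OF _ W_ideal_uminus, of x y] by simp

text \<open>The compatibility that lets the linear extension of a functional on words descend to the
  quotient algebra W. Statements about W are read off through such functionals.\<close>

definition respects_relations :: "(int list \<Rightarrow> complex poly) \<Rightarrow> bool" where
  "respects_relations F \<longleftrightarrow> (\<forall>v a b w. F (v @ [a, b] @ w) =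
     F (v @ [b, a] @ w) + (if a + b = 0 then [:0, \<i> * of_int a:] else 0) * F (v @ w))"

lemma additive_mult_right: "additive (\<lambda>c::'a::ring. c * x)"
  by standard (simp add: distrib_right)

lemma linext_W_ideal:
  assumes "respects_relations F" and "x \<in> W_ideal"
  shows "linext (\<lambda>w c. c * F w) x = 0"
  using assms(2)
proof induction
  case zero
  then show ?case by (simp add: linext_def)
next
  case (step x v a b w c)
  interpret additive "linext (\<lambda>w c. c * F w)"
    by (intro additive_linext additive_mult_right)
  have "F (v @ [a, b] @ w) = 
     F (v @ [b, a] @ w) + (if a + b = 0 then [:0, \<i> * of_int a:] else 0) * F (v @ w)"
    using assms(1) unfolding respects_relations_def by blast
  then show ?case using step.IH
    by (simp add: add diff linext_single algebra_simps del: append.simps append_Cons)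
qed

text \<open>The Fock representation on polynomials in the \<open>p_a\<close>: \<open>p_a\<close> acts as multiplication for
  \<open>a \<le> 0\<close>, and as multiplication plus \<open>\<i>\<hbar>a \<partial>/\<partial>p_{-a}\<close> for \<open>a > 0\<close>.\<close>

definition fock :: "int \<Rightarrow> (int multiset \<Rightarrow> complex poly) \<Rightarrow> int multiset \<Rightarrow> complex poly" where
  "fock a h = (\<lambda>K. (if a \<in># K then h (K - {#a#}) else 0) +
     (if a > 0 then [:0, \<i> * of_int a * of_nat (Suc (count K (- a))):] * h (add_mset (- a) K) else 0))"

text \<open>The word acting on the vacuum 1. Its value at K turns out to be the coefficient of the
  monomial K in the normal form of the word.\<close>

definition nform :: "int list \<Rightarrow> int multiset \<Rightarrow> complex poly" where
  "nform w = foldr fock w (\<lambda>K. if K = {#} then 1 else 0)"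

lemma nform_Nil: "nform [] K = (if K = {#} then 1 else 0)"
  and nform_Cons: "nform (a # w) = fock a (nform w)"
  by (simp_all add: nform_def)

text \<open>Canonical commutation relation: multiplication by the variable of index
  \<open>- a\<close> raises its exponent by one, so the derivative factor counts
  \<open>Suc (count K (- a))\<close> in one order and \<open>count K (- a)\<close> in the
  other.\<close>

lemma fock_commute_opposite:
  assumes "a > 0"
  shows "fock a (fock (- a) h) K = fock (- a) (fock a h) K + [:0, \<i> * of_int a:] * h K"
proof -
  define c where "c n = [:0, \<i> * of_int a * of_nat n:]" for n
  have c: "c (Suc n) = c n + [:0, \<i> * of_int a:]" for n
    by (simp add: c_def algebra_simps)
  have c0: "c 0 = 0" by (simp add: c_def)
  have neq: "a \<noteq> - a" using assms by simp
  have plus: "fock a g K = (if a \<in># K then g (K - {#a#}) else 0) + c (Suc (count K (- a))) * g (add_mset (- a) K)" for g K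
    using assms by (simp add: fock_def c_def)
  have minus: "fock (- a) g K = (if - a \<in># K then g (K - {#- a#}) else 0)" for g K
    using assms by (simp add: fock_def)
  have m: "- a \<in># K - {#a#} \<longleftrightarrow> - a \<in># K" "a \<in># K - {#- a#} \<longleftrightarrow> a \<in># K"
    "K - {#- a#} - {#a#} = K - {#a#} - {#- a#}"
    using neq by (auto simp: in_diff_count intro: multiset_eqI)
  show ?thesis
  proof (cases "- a \<in># K")
    case True
    then have *: "add_mset (- a) (K - {#- a#}) = K" "Suc (count (K - {#- a#}) (- a)) = count K (- a)"
      by (simp_all add: Suc_leI)
    show ?thesis unfolding plus minus m if_P[OF True] * c distrib_right by simp
  next
    case False
    then have "count K (- a) = 0" by (simp add: not_in_iff)
    then show ?thesis using False unfolding plus minus m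
      by (simp add: c c0)
  qed
qed

lemma fock_commute:
  "fock a (fock b h) K = fock b (fock a h) K + (if a + b = 0 then [:0, \<i> * of_int a:] else 0) * h K"
proof (cases "a = b")
  case True
  then show ?thesis by simp
next
  case neq: False
  define ca where "ca = [:0, \<i> * of_int a * of_nat (Suc (count K (- a))):]"
  define cb where "cb = [:0, \<i> * of_int b * of_nat (Suc (count K (- b))):]"
  have m: "b \<in># K - {#a#} \<longleftrightarrow> b \<in># K" "a \<in># K - {#b#} \<longleftrightarrow> a \<in># K"
    using neq by (simp_all add: in_diff_count)
  show ?thesis
  proof (cases "a + b = 0")
    case False
    then have ne: "b \<noteq> - a" "a \<noteq> - b" "- a \<noteq> b" "- b \<noteq> a" by auto
    have sw: "add_mset (- b) (K - {#a#}) = add_mset (- b) K - {#a#}"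
      "add_mset (- a) (K - {#b#}) = add_mset (- a) K - {#b#}"
      "K - {#a#} - {#b#} = K - {#b#} - {#a#}"
      using ne by (auto intro!: multiset_eqI)
    have m': "a \<in># add_mset (- b) K \<longleftrightarrow> a \<in># K" "b \<in># add_mset (- a) K \<longleftrightarrow> b \<in># K"
      "count (K - {#a#}) (- b) = count K (- b)" "count (K - {#b#}) (- a) = count K (- a)"
      "count (add_mset (- a) K) (- b) = count K (- b)" "count (add_mset (- b) K) (- a) = count K (- a)"
      using ne neq by auto
    show ?thesis
      unfolding fock_def m m' sw add_mset_commute[of "-a" "-b"] if_not_P[OF False]
        ca_def[symmetric] cb_def[symmetric]
      by (cases "a \<in># K"; cases "b \<in># K"; cases "0 < a"; cases "0 < b"; simp only: simp_thms if_True if_False)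
        (simp_all only: algebra_simps mult_zero_left mult_zero_right add_0_left add_0_right)
  next
    case True
    then have b: "b = - a" by simp
    show ?thesis
    proof (cases "a > 0")
      case True
      with fock_commute_opposite[of a h K] b show ?thesis by simp
    next
      case False
      with neq b have "- a > 0" by simp
      from fock_commute_opposite[OF this, of h K] b show ?thesis by simp
    qed
  qed
qed

lemma fock_add_mult: "fock x (\<lambda>K. f K + c * g K) K = fock x f K + c * fock x g K"
proof -
  define d where "d = [:0, \<i> * of_int x * of_nat (Suc (count K (- x))):]"
  show ?thesis
    unfolding fock_def d_def[symmetric]
    by (cases "x \<in># K"; cases "x > 0"; simp only: if_True if_False simp_thms)
      (simp_all only: algebra_simps mult_zero_right mult_zero_left add_0_left add_0_right)
qed

lemma respects_relations_nform: "respects_relations (\<lambda>w. nform w K)"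
proof -
  have "nform (v @ [a, b] @ w) K =
    nform (v @ [b, a] @ w) K + (if a + b = 0 then [:0, \<i> * of_int a:] else 0) * nform (v @ w) K" for v a b w
  proof (induction v arbitrary: K)
    case Nil
    then show ?case by (simp add: nform_Cons fock_commute[of a b])
  next
    case (Cons x v)
    then have "nform (v @ [a, b] @ w) = (\<lambda>K. nform (v @ [b, a] @ w) K +
        (if a + b = 0 then [:0, \<i> * of_int a:] else 0) * nform (v @ w) K)"
      by (intro ext)
    then show ?case
      unfolding append_Cons nform_Cons[of x] by (simp only: fock_add_mult)
  qed
  then show ?thesis unfolding respects_relations_def by blast
qed

text \<open>A positive letter \<open>a\<close> in a sorted word has only letters \<ge>
  \<open>a\<close> to its right, so its derivative finds no \<open>- a\<close> to act on and the
  word acts by pure multiplication.\<close>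

lemma nform_sorted: "sorted w \<Longrightarrow> nform w K = (if K = mset w then 1 else 0)"
proof (induction w arbitrary: K)
  case (Cons a w)
  have IH: "nform w K = (if K = mset w then 1 else 0)" for K
    using Cons by simp
  have "add_mset (- a) K \<noteq> mset w" if "a > 0"
  proof
    assume "add_mset (- a) K = mset w"
    then have "- a \<in> set w" by (metis set_mset_mset union_single_eq_member)
    with Cons.prems have "a \<le> - a" unfolding sorted_simps(2) by blast
    with that show False by simp
  qed
  then have "nform (a # w) K = (if a \<in># K then if K - {#a#} = mset w then 1 else 0 else 0)"
    unfolding nform_Cons fock_def IH by simp
  moreover have "a \<in># K \<and> K - {#a#} = mset w \<longleftrightarrow> K = mset (a # w)"
    by (auto dest!: multi_member_split)
  ultimately show ?case
    by (cases "a \<in># K"; cases "K - {#a#} = mset w") (simp_all only: simp_thms if_True if_False)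
qed (simp add: nform_Nil)

lemma linext_delta:
  fixes h :: "'k \<Rightarrow>\<^sub>0 'c::comm_ring_1"
  shows "linext (\<lambda>M c. c * (if K = M then 1 else 0)) h = Poly_Mapping.lookup h K"
proof -
  have "linext (\<lambda>M c. c * (if K = M then 1 else 0)) h = (\<Sum>M\<in>insert K (Poly_Mapping.keys h). Poly_Mapping.lookup h M * (if K = M then 1 else 0))"
    by (rule linext_superset) auto
  also have "\<dots> = Poly_Mapping.lookup h K"
    by (simp add: if_distrib[of "\<lambda>y. _ * y"] cong: if_cong)
  finally show ?thesis .
qed

lemma linext_normal_ordering:
  "linext (\<lambda>w c. c * F w) (normal_ordering h) = linext (\<lambda>M c. c * F (normal_word M)) h"
proof -
  interpret additive "linext (\<lambda>w c. c * F w)"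
    by (intro additive_linext additive_mult_right)
  show ?thesis
    by (simp add: normal_ordering_def sum linext_single) (simp add: linext_def)
qed

lemma normal_ordering_functional:
  assumes "respects_relations F" and "normal_ordering h - Poly_Mapping.single w c \<in> W_ideal"
  shows "c * F w = linext (\<lambda>M c. c * F (normal_word M)) h"
proof -
  interpret additive "linext (\<lambda>w c. c * F w)"
    by (intro additive_linext additive_mult_right)
  from linext_W_ideal[OF assms] show ?thesis
    by (simp add: diff linext_single linext_normal_ordering)
qed

text \<open>Uniqueness half of a Poincare-Birkhoff-Witt theorem: on sorted words the functional at K
  is the indicator of one monomial, so it extracts the coefficient at K from any normal
  form.\<close>

lemma normal_ordering_unique:
  assumes "normal_ordering h - Poly_Mapping.single w 1 \<in> W_ideal"
  shows "Poly_Mapping.lookup h K = nform w K"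
  using normal_ordering_functional[OF respects_relations_nform assms, of K]
  by (simp add: nform_sorted normal_word_def linext_delta)

section \<open>Existence of normal forms\<close>

definition normalizable :: "(int list \<Rightarrow>\<^sub>0 complex poly) \<Rightarrow> bool" where
  "normalizable x \<longleftrightarrow> (\<exists>h. normal_ordering h - x \<in> W_ideal)"

lemma normalizable_add: "normalizable x \<Longrightarrow> normalizable y \<Longrightarrow> normalizable (x + y)"
proof -
  interpret additive normal_ordering by (rule additive_normal_ordering)
  assume "normalizable x" "normalizable y"
  then obtain h k where "normal_ordering h - x \<in> W_ideal" "normal_ordering k - y \<in> W_ideal"
    by (auto simp: normalizable_def)
  from W_ideal_add[OF this] have "normal_ordering (h + k) - (x + y) \<in> W_ideal"
    by (simp add: add algebra_simps)
  then show ?thesis by (auto simp: normalizable_def)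
qed

lemma normalizable_cong: "normalizable y \<Longrightarrow> x - y \<in> W_ideal \<Longrightarrow> normalizable x"
  unfolding normalizable_def using W_ideal_diff[of _ "x - y"] by force

lemma normalizable_0: "normalizable 0"
  unfolding normalizable_def using W_ideal.zero by (auto intro!: exI[of _ 0] simp: normal_ordering_def)

lemma normalizable_sum: "(\<And>i. i \<in> S \<Longrightarrow> normalizable (f i)) \<Longrightarrow> normalizable (sum f S)"
  by (induction S rule: infinite_finite_induct) (auto simp: normalizable_0 normalizable_add)

lemma normalizable_sorted: "sorted w \<Longrightarrow> normalizable (Poly_Mapping.single w c)"
  unfolding normalizable_def using W_ideal.zero
  by (auto intro!: exI[of _ "Poly_Mapping.single (mset w) c"]
      simp: normal_ordering_single normal_word_def sorted_sort_id)

text \<open>While \<open>a\<close> travels right past the smaller letters, each copy of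
  \<open>- a\<close> it meets costs one contraction and leaves the same shortened word, whence the
  multiplicity factor. For \<open>a\<close> \<le> 0 all letters passed are negative and none
  contracts. The prefix \<open>v\<close> is arbitrary because the induction absorbs the passed
  letters into it.\<close>

lemma insert_sorted_W_ideal:
  assumes "sorted w"
  shows "Poly_Mapping.single (v @ a # w) c - Poly_Mapping.single (v @ insort a w) c
     - Poly_Mapping.single (v @ remove1 (- a) w)
         (if a > 0 then [:0, \<i> * of_int a * of_nat (count (mset w) (- a)):] * c else 0) \<in> W_ideal"
  using assms
proof (induction w arbitrary: v)
  case Nil
  then show ?case by (simp add: W_ideal.zero)
next
  case (Cons b w)
  show ?case
  proof (cases "a \<le> b")
    case True
    have "- a \<notin> set (b # w)" if "a > 0"
      using that True Cons.prems by fastforce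
    then have "count (mset (b # w)) (- a) = 0" if "a > 0"
      using that by (simp add: not_in_iff[symmetric] del: mset.simps)
    then have "(if a > 0 then [:0, \<i> * of_int a * of_nat (count (mset (b # w)) (- a)):] * c else 0) = 0"
      by (simp only: of_nat_0 mult_zero_right pCons_0_0 mult_zero_left if_cancel cong: if_cong)
    moreover have "insort a (b # w) = a # b # w" using True by simp
    ultimately show ?thesis
      by (simp only: single_zero diff_self diff_zero W_ideal.zero)
  next
    case False
    from Cons have "sorted w" by simp
    from Cons.IH[OF this, of "v @ [b]"]
    have IH: "Poly_Mapping.single (v @ b # a # w) c - Poly_Mapping.single (v @ b # insort a w) c
     - Poly_Mapping.single (v @ b # remove1 (- a) w)
         (if a > 0 then [:0, \<i> * of_int a * of_nat (count (mset w) (- a)):] * c else 0) \<in> W_ideal"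
      (is "?I1 - ?I2 - ?I3 \<in> _") by (simp only: append_assoc append_Cons append_Nil)
    have rel: "Poly_Mapping.single (v @ a # b # w) c - Poly_Mapping.single (v @ b # a # w) c
     - Poly_Mapping.single (v @ w) (if a + b = 0 then [:0, \<i> * of_int a:] * c else 0) \<in> W_ideal"
      (is "?R1 - ?I1 - ?R3 \<in> _") using W_ideal_relation[of v a b w c] by (simp only: append_assoc append_Cons append_Nil)
    have "?R3 + ?I3 = Poly_Mapping.single (v @ remove1 (- a) (b # w))
         (if a > 0 then [:0, \<i> * of_int a * of_nat (count (mset (b # w)) (- a)):] * c else 0)"
    proof (cases "a + b = 0")
      case True
      then have b: "b = - a" and "a > 0" using False by auto
      show ?thesis
      proof (cases "b \<in> set w")
        case True
        \<comment> \<open>Equal letters of a sorted word are adjacent, so removing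
          \<open>- a\<close> from \<open>w\<close> and dropping the head \<open>b\<close> give the
          same word up to the retained copy, and the two contraction terms add up.\<close>
        with Cons.prems obtain u where "w = b # u"
          by (cases w) (auto dest: antisym)
        moreover have "[:0, \<i> * of_int a:] * c + [:0, \<i> * of_int a * of_nat n:] * c =
            [:0, \<i> * of_int a * of_nat (Suc n):] * c" for n
          unfolding distrib_right[symmetric] by (simp add: distrib_left)
        ultimately show ?thesis using \<open>a > 0\<close> b
          by (simp del: mult_pCons_left of_nat_Suc flip: single_add)
      next
        case False
        then have "count (mset w) (- a) = 0" using b by (simp add: count_eq_zero_iff)
        then show ?thesis using \<open>a > 0\<close> b by (simp del: count_mset_0_iff)
      qed
    next
      case False
      then have "b \<noteq> - a" by auto
      then show ?thesis by (simp only: if_not_P[OF False] single_zero add_0_left) simp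
    qed
    moreover have "(i1 - i2 - i3) + (r1 - i1 - r3) = r1 - i2 - (r3 + i3)"
      for i1 i2 i3 r1 r3 :: "int list \<Rightarrow>\<^sub>0 complex poly" by simp
    ultimately have "?R1 - ?I2 - Poly_Mapping.single (v @ remove1 (- a) (b # w))
         (if a > 0 then [:0, \<i> * of_int a * of_nat (count (mset (b # w)) (- a)):] * c else 0) \<in> W_ideal"
      using W_ideal_add[OF IH rel] by (simp only:)
    then show ?thesis using False by (simp only: insort_key.simps if_False)
  qed
qed

definition prefix_letter :: "int \<Rightarrow> (int list \<Rightarrow>\<^sub>0 complex poly) \<Rightarrow> (int list \<Rightarrow>\<^sub>0 complex poly)" where
  "prefix_letter a = linext (\<lambda>w. Poly_Mapping.single (a # w))"

lemma additive_prefix_letter: "additive (prefix_letter a)"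
  unfolding prefix_letter_def by (intro additive_linext additive_single)

lemma prefix_letter_single: "prefix_letter a (Poly_Mapping.single w c) = Poly_Mapping.single (a # w) c"
  by (simp add: prefix_letter_def linext_single)

lemma prefix_letter_W_ideal: "x \<in> W_ideal \<Longrightarrow> prefix_letter a x \<in> W_ideal"
proof (induction x rule: W_ideal.induct)
  case zero
  then show ?case by (simp add: prefix_letter_def linext_def W_ideal.zero)
next
  case (step x v b c w d)
  interpret additive "prefix_letter a" by (rule additive_prefix_letter)
  from W_ideal.step[OF step.IH, of "a # v" b c w d] show ?case
    by (simp add: add diff prefix_letter_single)
qed

text \<open>Prefixing a letter preserves the ideal, so the tail may be replaced by its normal form;
  what remains is a letter in front of sorted words, which insertion settles.\<close>

lemma normalizable_single: "normalizable (Poly_Mapping.single w c)"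
proof (induction w)
  case Nil
  then show ?case by (simp add: normalizable_sorted)
next
  case (Cons a w)
  interpret additive "prefix_letter a" by (rule additive_prefix_letter)
  from Cons obtain h where "normal_ordering h - Poly_Mapping.single w c \<in> W_ideal"
    by (auto simp: normalizable_def)
  then have "prefix_letter a (normal_ordering h - Poly_Mapping.single w c) \<in> W_ideal"
    by (rule prefix_letter_W_ideal)
  then have rel: "Poly_Mapping.single (a # w) c - prefix_letter a (normal_ordering h) \<in> W_ideal"
    by (simp add: diff prefix_letter_single) (metis W_ideal_uminus minus_diff_eq)
  have "normalizable (Poly_Mapping.single (a # normal_word M) d)" for M d
  proof (rule normalizable_cong)
    show "normalizable (Poly_Mapping.single (insort a (normal_word M)) d + Poly_Mapping.single (remove1 (- a) (normal_word M))
         (if a > 0 then [:0, \<i> * of_int a * of_nat (count (mset (normal_word M)) (- a)):] * d else 0))"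
      by (intro normalizable_add normalizable_sorted sorted_insort[THEN iffD2] sorted_remove1)
        (simp_all add: normal_word_def)
    show "Poly_Mapping.single (a # normal_word M) d - (Poly_Mapping.single (insort a (normal_word M)) d + Poly_Mapping.single (remove1 (- a) (normal_word M))
         (if a > 0 then [:0, \<i> * of_int a * of_nat (count (mset (normal_word M)) (- a)):] * d else 0)) \<in> W_ideal"
      using insert_sorted_W_ideal[of "normal_word M" "[]" a d]
      by (simp add: normal_word_def diff_diff_add)
  qed
  then have "normalizable (prefix_letter a (normal_ordering h))"
    by (simp add: normal_ordering_def sum prefix_letter_single normalizable_sum)
  from normalizable_cong[OF this rel] show ?case .
qed

text \<open>Existence and uniqueness of the normal form resolve the definite description in
  \<open>star_monom\<close>; structure constants can now be computed in the Fock
  representation.\<close>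

lemma lookup_star_monom:
  "Poly_Mapping.lookup (star_monom M N) K = nform (normal_word M @ normal_word N) K"
proof -
  let ?w = "normal_word M @ normal_word N"
  obtain h where h: "normal_ordering h - Poly_Mapping.single ?w 1 \<in> W_ideal"
    using normalizable_single[of ?w 1] by (auto simp: normalizable_def)
  have "star_monom M N = h"
    unfolding star_monom_def
  proof (rule the_equality, rule h)
    fix k assume "normal_ordering k - Poly_Mapping.single ?w 1 \<in> W_ideal"
    then show "k = h"
      by (intro poly_mapping_eqI) (simp add: normal_ordering_unique[OF h] normal_ordering_unique)
  qed
  then show ?thesis by (simp add: normal_ordering_unique[OF h])
qed

section \<open>The reflection anti-automorphism\<close>

abbreviation reflect :: "int multiset \<Rightarrow> int multiset" where
  "reflect \<equiv> image_mset uminus"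

lemma reflect_reflect [simp]: "reflect (reflect M) = M"
  by (simp add: multiset.map_comp comp_def)

lemma sum_mset_reflect: "sum_mset (reflect M) = - sum_mset M"
  by (induction M) auto

lemma rev_map_uminus_normal_word: "rev (map uminus (normal_word M)) = normal_word (reflect M)"
proof -
  have "sorted (map uminus (rev (normal_word M)))"
    unfolding sorted_map by (simp add: normal_word_def sorted_wrt_rev)
  then have "sort (map uminus (rev (normal_word M))) = map uminus (rev (normal_word M))"
    by (rule sorted_sort_id)
  moreover have "mset (map uminus (rev (normal_word M))) = reflect M"
    by (simp add: normal_word_def)
  ultimately show ?thesis
    by (metis normal_word_def rev_map sorted_list_of_multiset_mset)
qed

text \<open>\<open>p_a \<mapsto> p_{-a}\<close> is an anti-automorphism of \<open>W\<close> and maps normally ordered words to normally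
  ordered words.\<close>

lemma respects_relations_reflect:
  assumes "respects_relations F"
  shows "respects_relations (\<lambda>w. F (rev (map uminus w)))"
  unfolding respects_relations_def
proof (intro allI)
  fix v w and a b :: int
  have "F (rev (map uminus w) @ [- b, - a] @ rev (map uminus v)) =
     F (rev (map uminus w) @ [- a, - b] @ rev (map uminus v)) +
     (if - b + - a = 0 then [:0, \<i> * of_int (- b):] else 0) * F (rev (map uminus w) @ rev (map uminus v))"
    using assms unfolding respects_relations_def by blast
  then show "F (rev (map uminus (v @ [a, b] @ w))) = F (rev (map uminus (v @ [b, a] @ w))) +
     (if a + b = 0 then [:0, \<i> * of_int a:] else 0) * F (rev (map uminus (v @ w)))"
    by (cases "a + b = 0") (simp_all add: add_eq_0_iff del: mult_pCons_left)
qed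

text \<open>Both sides equal the coefficient at K of a normal form \<open>h\<close> of
  \<open>w\<close>: the reflected functional also respects the relations and sends sorted words to
  sorted words, so it reads off the same coefficient.\<close>

lemma nform_reflect: "nform (rev (map uminus w)) (reflect K) = nform w K"
proof -
  obtain h where h: "normal_ordering h - Poly_Mapping.single w 1 \<in> W_ideal"
    using normalizable_single[of w 1] by (auto simp: normalizable_def)
  have inj: "reflect K = reflect M \<longleftrightarrow> K = M" for M
    by (metis reflect_reflect)
  have "sorted (normal_word M)" "mset (normal_word M) = M" for M
    by (simp_all add: normal_word_def)
  then show ?thesis
    using normal_ordering_functional[OF respects_relations_reflect[OF respects_relations_nform] h, of "reflect K"]
    by (simp add: rev_map_uminus_normal_word nform_sorted inj linext_delta
        normal_ordering_unique[OF h])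
qed

section \<open>Structure constants of the star product\<close>

definition star_coeff :: "int multiset \<Rightarrow> int multiset \<Rightarrow> int multiset \<Rightarrow> nat \<Rightarrow> complex" where
  "star_coeff M N K k = coeff (Poly_Mapping.lookup (star_monom M N) K) k"

lemma star_coeff_reflect: "star_coeff (reflect N) (reflect M) (reflect K) k = star_coeff M N K k"
  using nform_reflect[of "normal_word M @ normal_word N" K]
  by (simp add: star_coeff_def lookup_star_monom rev_map_uminus_normal_word)

lemma coeff_fock_0: "coeff (fock a h K) 0 = (if a \<in># K then coeff (h (K - {#a#})) 0 else 0)"
  by (simp add: fock_def)

lemma coeff_fock_Suc: "coeff (fock a h K) (Suc k) = (if a \<in># K then coeff (h (K - {#a#})) (Suc k) else 0) +
   (if a > 0 then \<i> * of_int a * of_nat (Suc (count K (- a))) * coeff (h (add_mset (- a) K)) k else 0)"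
  by (simp add: fock_def del: of_nat_Suc)

lemma coeff_nform_0: "coeff (nform w K) 0 = (if K = mset w then 1 else 0)"
proof (induction w arbitrary: K)
  case (Cons a w)
  have "a \<in># K \<and> K - {#a#} = mset w \<longleftrightarrow> K = mset (a # w)"
    by (auto dest!: multi_member_split)
  then show ?case
    by (cases "a \<in># K"; cases "K - {#a#} = mset w")
      (simp_all only: nform_Cons coeff_fock_0 Cons simp_thms if_True if_False)
qed (simp add: nform_Nil)

lemma star_coeff_0: "star_coeff M N K 0 = (if K = M + N then 1 else 0)"
  by (simp add: star_coeff_def lookup_star_monom coeff_nform_0 normal_word_def)

text \<open>Qualitative Wick theorem: the power of \<hbar> counts contractions, and \<open>P\<close>
  collects the contracted letters of the left word, each matched with its negative in the right
  word. They are positive because only positive letters act with a derivative.\<close>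

lemma coeff_nform_contraction:
  assumes "sorted xs" "sorted ys" "coeff (nform (xs @ ys) K) k \<noteq> 0"
  shows "\<exists>P K1 K2. mset xs = K1 + P \<and> mset ys = K2 + reflect P \<and> K = K1 + K2 \<and> size P = k \<and> (\<forall>a\<in>#P. 0 < a)"
  using assms
proof (induction xs arbitrary: K k)
  case Nil
  then have "K = mset ys" "k = 0" by (auto simp: nform_sorted split: if_splits)
  then show ?case by (intro exI[of _ "{#}"] exI[of _ "mset ys"]) simp
next
  case (Cons a xs)
  have srt: "sorted xs" and le: "\<forall>b\<in>set xs. a \<le> b" using Cons.prems by auto
  have "(a \<in># K \<and> coeff (nform (xs @ ys) (K - {#a#})) k \<noteq> 0) \<or>
     (\<exists>k'. k = Suc k' \<and> a > 0 \<and> coeff (nform (xs @ ys) (add_mset (- a) K)) k' \<noteq> 0)"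
    using Cons.prems(3) unfolding append_Cons nform_Cons
    by (cases k) (auto simp: coeff_fock_0 coeff_fock_Suc split: if_splits)
  then show ?case
  proof (elim disjE conjE exE)
    assume a: "a \<in># K" and "coeff (nform (xs @ ys) (K - {#a#})) k \<noteq> 0"
    then obtain P K1 K2 where *: "mset xs = K1 + P" "mset ys = K2 + reflect P" "K - {#a#} = K1 + K2"
      "size P = k" "\<forall>a\<in>#P. 0 < a"
      using Cons.IH[OF srt Cons.prems(2)] by blast
    then have "K = add_mset a K1 + K2" using a by (metis insert_DiffM union_mset_add_mset_left)
    with * show ?thesis by (intro exI[of _ P] exI[of _ "add_mset a K1"] exI[of _ K2]) simp
  next
    fix k' assume k: "k = Suc k'" and a: "a > 0" and "coeff (nform (xs @ ys) (add_mset (- a) K)) k' \<noteq> 0"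
    then obtain P K1 K2 where *: "mset xs = K1 + P" "mset ys = K2 + reflect P" "add_mset (- a) K = K1 + K2"
      "size P = k'" "\<forall>a\<in>#P. 0 < a"
      using Cons.IH[OF srt Cons.prems(2)] by blast
    \<comment> \<open>The letters after \<open>a\<close> in the sorted left word are at least
      \<open>a\<close> > 0, so the partner \<open>- a\<close> must come from the right word.\<close>
    have "- a \<notin> set xs" using le a by force
    then have "- a \<notin># K1" using *(1) by (metis set_mset_mset union_iff)
    then have "- a \<in># K2" using *(3) by (metis union_iff union_single_eq_member)
    then obtain K2' where K2: "K2 = add_mset (- a) K2'" by (auto dest: multi_member_split)
    show ?thesis using * k a K2
      by (intro exI[of _ "add_mset a P"] exI[of _ K1] exI[of _ K2']) simp
  qed
qed

lemma star_coeff_contraction: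
  assumes "star_coeff M N K k \<noteq> 0"
  obtains P K1 K2 where "M = K1 + P" "N = K2 + reflect P" "K = K1 + K2" "size P = k" "\<forall>a\<in>#P. 0 < a"
  using assms coeff_nform_contraction[of "normal_word M" "normal_word N" K k]
  by (auto simp: star_coeff_def lookup_star_monom normal_word_def)

lemma nform_size: "nform w K \<noteq> 0 \<Longrightarrow> size K \<le> length w"
proof (induction w arbitrary: K)
  case (Cons a w)
  then have "(a \<in># K \<and> nform w (K - {#a#}) \<noteq> 0) \<or> nform w (add_mset (- a) K) \<noteq> 0"
    by (auto simp: nform_Cons fock_def split: if_splits)
  then show ?case
  proof
    assume "a \<in># K \<and> nform w (K - {#a#}) \<noteq> 0"
    with Cons.IH[of "K - {#a#}"] show ?thesis by (auto simp: size_Diff_singleton)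
  next
    assume "nform w (add_mset (- a) K) \<noteq> 0"
    with Cons.IH[of "add_mset (- a) K"] show ?thesis by simp
  qed
qed (simp add: nform_Nil split: if_splits)

text \<open>Each left letter is kept or contracted, whence the power of 2. A contraction costs a
  letter of size at most R times a multiplicity, and multiplicities are bounded by the word length
  through \<open>nform_size\<close>. The sorted right word contributes 0 or 1.\<close>

lemma norm_coeff_nform_le:
  assumes "length (xs @ ys) \<le> q" "\<forall>a\<in>set xs. real_of_int \<bar>a\<bar> \<le> R" "sorted ys" "R \<ge> 0"
  shows "norm (coeff (nform (xs @ ys) K) k) \<le> 2 ^ length xs * (q * R) ^ k"
  using assms(1,2)
proof (induction xs arbitrary: K k)
  case Nil
  then show ?case using assms(3,4) by (cases k) (auto simp: nform_sorted)
next
  case (Cons a xs)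
  have IH: "norm (coeff (nform (xs @ ys) K) k) \<le> 2 ^ length xs * (q * R) ^ k" for K k
    using Cons by simp
  have nonneg: "0 \<le> 2 ^ length xs * (q * R) ^ k" for k using assms(4) by simp
  have one: "norm (if a \<in># K then coeff (nform (xs @ ys) (K - {#a#})) k else 0) \<le> 2 ^ length xs * (q * R) ^ k"
    using IH nonneg by simp
  show ?case
  proof (cases k)
    case 0
    then have "norm (coeff (nform ((a # xs) @ ys) K) k) \<le> 2 ^ length xs * (q * R) ^ k"
      using one by (simp only: append_Cons nform_Cons coeff_fock_0)
    with nonneg[of k] show ?thesis by simp
  next
    case (Suc k')
    let ?y = "\<i> * of_int a * of_nat (Suc (count K (- a))) * coeff (nform (xs @ ys) (add_mset (- a) K)) k'"
    have two: "norm ?y \<le> 2 ^ length xs * (q * R) ^ k"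
    proof (cases "nform (xs @ ys) (add_mset (- a) K) = 0")
      case True
      then show ?thesis using nonneg by simp
    next
      case False
      from nform_size[OF this] Cons.prems(1) count_le_size[of K "- a"]
      have "Suc (count K (- a)) \<le> q" by simp
      then have "real (Suc (count K (- a))) \<le> q" by (simp only: of_nat_le_iff)
      moreover have "\<bar>real_of_int a\<bar> \<le> R" using Cons.prems(2) by simp
      ultimately have "\<bar>real_of_int a\<bar> * real (Suc (count K (- a))) * norm (coeff (nform (xs @ ys) (add_mset (- a) K)) k')
        \<le> R * q * (2 ^ length xs * (q * R) ^ k')"
        using assms(4) by (intro mult_mono IH) auto
      then show ?thesis using Suc by (simp add: norm_mult algebra_simps del: of_nat_Suc)
    qed
    have "coeff (nform ((a # xs) @ ys) K) k = (if a \<in># K then coeff (nform (xs @ ys) (K - {#a#})) k else 0) + (if a > 0 then ?y else 0)"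
      by (simp only: Suc append_Cons nform_Cons coeff_fock_Suc)
    also have "norm \<dots> \<le> 2 ^ length xs * (q * R) ^ k + 2 ^ length xs * (q * R) ^ k"
      by (intro norm_triangle_mono one) (use two nonneg in auto)
    finally show ?thesis by simp
  qed
qed

lemma norm_star_coeff_le:
  assumes "\<forall>a\<in>#M. real_of_int \<bar>a\<bar> \<le> R" "R \<ge> 0" "size M + size N \<le> q"
  shows "norm (star_coeff M N K k) \<le> 2 ^ size M * (q * R) ^ k"
proof -
  have "length (normal_word M) = size M" for M
    by (metis mset_sorted_list_of_multiset normal_word_def size_mset)
  then show ?thesis
    using norm_coeff_nform_le[of "normal_word M" "normal_word N" q R K k] assms
    by (simp add: star_coeff_def lookup_star_monom normal_word_def)
qed

section \<open>Contractions\<close>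

text \<open>The part of a product of two series free of \<hbar> that has exactly \<open>k\<close>
  contractions. Splitting the star product by \<open>k\<close> makes the gain in growth
  visible.\<close>

definition contract :: "(int multiset \<Rightarrow> complex) \<Rightarrow> (int multiset \<Rightarrow> complex) \<Rightarrow> int multiset \<Rightarrow> nat \<Rightarrow> complex" where
  "contract f g K k = Sum_any (\<lambda>(M, N). f M * g N * star_coeff M N K k)"

lemma contract_nonzero:
  assumes "contract f g K k \<noteq> 0"
  obtains M N where "f M \<noteq> 0" "g N \<noteq> 0" "star_coeff M N K k \<noteq> 0"
proof -
  from assms obtain MN where "(case MN of (M, N) \<Rightarrow> f M * g N * star_coeff M N K k) \<noteq> 0"
    unfolding contract_def by (rule Sum_any.not_neutral_obtains_not_neutral)
  then show ?thesis using that by (auto split: prod.splits)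
qed

lemma Sum_any_mult_left:
  fixes g :: "'b \<Rightarrow> 'c::field"
  shows "Sum_any (\<lambda>x. c * g x) = c * Sum_any g"
proof (cases "finite {x. g x \<noteq> 0}")
  case True
  then show ?thesis by (simp add: Sum_any_right_distrib)
next
  case False
  then show ?thesis by (cases "c = 0") simp_all
qed

text \<open>Reindexing by (M, N) \<mapsto> (\<open>reflect N\<close>, \<open>reflect M\<close>): the
  reflection reverses the factors, hence \<open>g\<close> and \<open>f\<close> change places on the
  right.\<close>

lemma contract_reflect:
  assumes "\<And>M. f' (reflect M) = s * f M" and "\<And>N. g' (reflect N) = t * g N"
  shows "contract f' g' (reflect K) k = s * t * contract g f K k"
proof -
  let ?l = "\<lambda>(M, N). (reflect N, reflect M)"
  have bij: "bij ?l"
    by (rule o_bij[of ?l]) (auto simp: fun_eq_iff)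
  have "contract f' g' (reflect K) k = Sum_any (\<lambda>x. s * t * (case x of (M, N) \<Rightarrow> g M * f N * star_coeff M N K k))"
    unfolding contract_def
    by (rule Sum_any.reindex_cong[OF bij]) (auto simp: fun_eq_iff assms star_coeff_reflect)
  then show ?thesis by (simp add: Sum_any_mult_left contract_def)
qed

text \<open>Without contractions the star product is the commutative one, so commutators start at
  order \<hbar>.\<close>

lemma contract_0_commute: "contract f g K 0 = contract g f K 0"
  unfolding contract_def
  by (rule Sum_any.reindex_cong[of prod.swap]) (auto simp: fun_eq_iff star_coeff_0 ac_simps)

lemma finite_card_submultisets: "finite {K1. K1 \<subseteq># K} \<and> card {K1. K1 \<subseteq># K} \<le> 2 ^ size K"
proof (induction K)
  case (add a K)
  have sub: "{K1. K1 \<subseteq># add_mset a K} \<subseteq> {K1. K1 \<subseteq># K} \<union> add_mset a ` {K1. K1 \<subseteq># K}"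
  proof
    fix K1 assume "K1 \<in> {K1. K1 \<subseteq># add_mset a K}"
    then have K1: "K1 \<subseteq># add_mset a K" by simp
    show "K1 \<in> {K1. K1 \<subseteq># K} \<union> add_mset a ` {K1. K1 \<subseteq># K}"
    proof (cases "a \<in># K1")
      case True
      then obtain K1' where "K1 = add_mset a K1'" by (auto dest: multi_member_split)
      with K1 show ?thesis by auto
    next
      case False
      have "K1 - {#a#} \<subseteq># K" using K1 by (simp add: subset_eq_diff_conv)
      then show ?thesis using False by (simp add: diff_single_trivial)
    qed
  qed
  have fin: "finite ({K1. K1 \<subseteq># K} \<union> add_mset a ` {K1. K1 \<subseteq># K})" using add by simp
  have "card {K1. K1 \<subseteq># add_mset a K} \<le> card {K1. K1 \<subseteq># K} + card (add_mset a ` {K1. K1 \<subseteq># K})"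
    using card_mono[OF fin sub] card_Un_le order_trans by blast
  also have "\<dots> \<le> 2 ^ size K + 2 ^ size K"
    using add card_image_le[of "{K1. K1 \<subseteq># K}" "add_mset a"] by (intro add_mono) linarith+
  finally show ?case using finite_subset[OF sub fin] by simp
qed simp

lemma abs_sum_mset_le:
  assumes "\<forall>a\<in>#K. \<bar>a\<bar> \<le> (R::int)"
  shows "\<bar>sum_mset K\<bar> \<le> int (size K) * R"
  using assms by (induction K) (auto simp: algebra_simps)

lemma member_le_sum_mset:
  assumes "\<forall>a\<in>#P. 0 < (a::int)" "b \<in># P"
  shows "b \<le> sum_mset P"
proof -
  have "0 \<le> sum_mset P \<and> (\<forall>b\<in>#P. b \<le> sum_mset P)"
    using assms(1) by (induction P) auto
  with assms(2) show ?thesis by blast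
qed

text \<open>A contributing pair is given by a splitting K = K1 + K2 and the contracted multiset P.
  As the letters of one factor sum to 0, the splitting determines the sum of P, so only k - 1
  positive entries are free, each at most m R. The last factor bounds a single term, all letters of
  M and N being at most \<open>Suc m * R\<close>.\<close>

lemma contract_bound:
  fixes R :: nat
  assumes K: "size K \<le> m" "\<forall>a\<in>#K. \<bar>a\<bar> \<le> int R" and k: "k \<ge> 1" and B: "0 \<le> B1" "0 \<le> B2"
    and zero: "(\<forall>M. f M \<noteq> 0 \<longrightarrow> sum_mset M = 0) \<or> (\<forall>N. g N \<noteq> 0 \<longrightarrow> sum_mset N = 0)"
    and f: "\<And>M. size M \<le> m + k \<Longrightarrow> \<forall>a\<in>#M. \<bar>a\<bar> \<le> int (Suc m * R) \<Longrightarrow> norm (f M) \<le> B1"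
    and g: "\<And>N. size N \<le> m + k \<Longrightarrow> \<forall>a\<in>#N. \<bar>a\<bar> \<le> int (Suc m * R) \<Longrightarrow> norm (g N) \<le> B2"
  shows "norm (contract f g K k) \<le>
    2 ^ m * real (Suc m * R) ^ (k - 1) * (B1 * B2 * (2 ^ (m + k) * (real (2 * (m + k)) * real (Suc m * R)) ^ k))"
    (is "_ \<le> 2 ^ m * ?c * ?B")
proof -
  define h where "h = (\<lambda>(M, N). f M * g N * star_coeff M N K k)"
  have B0: "?B \<ge> 0" using B by simp
  \<comment> \<open>The forced sum of P: minus the sum of K1 if the left factor is a zero mode, the
    sum of K2 if the right one is.\<close>
  obtain s :: "int multiset \<Rightarrow> int multiset \<Rightarrow> int" where
    s: "\<And>P K1 K2. f (K1 + P) \<noteq> 0 \<Longrightarrow> g (K2 + reflect P) \<noteq> 0 \<Longrightarrow> sum_mset P = s K1 K2" and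
    s_le: "\<And>K1 K2. K = K1 + K2 \<Longrightarrow> s K1 K2 \<le> int (m * R)"
  proof (cases "\<forall>M. f M \<noteq> 0 \<longrightarrow> sum_mset M = 0")
    case True
    show ?thesis
    proof (rule that[of "\<lambda>K1 K2. - sum_mset K1"])
      fix P K1 K2 assume "f (K1 + P) \<noteq> 0"
      with True have "sum_mset (K1 + P) = 0" by blast
      then show "sum_mset P = - sum_mset K1" by simp
    next
      fix K1 K2 assume eq: "K = K1 + K2"
      have "\<bar>sum_mset K1\<bar> \<le> int (size K1) * int R"
        using K(2) eq by (intro abs_sum_mset_le) auto
      also have "\<dots> \<le> int m * int R" using K(1) eq by (intro mult_right_mono) auto
      finally show "- sum_mset K1 \<le> int (m * R)" by simp
    qed
  next
    case False
    with zero have z: "\<forall>N. g N \<noteq> 0 \<longrightarrow> sum_mset N = 0" by blast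
    show ?thesis
    proof (rule that[of "\<lambda>K1 K2. sum_mset K2"])
      fix P K1 K2 assume "g (K2 + reflect P) \<noteq> 0"
      with z have "sum_mset (K2 + reflect P) = 0" by blast
      then show "sum_mset P = sum_mset K2" by (simp add: sum_mset_reflect)
    next
      fix K1 K2 assume eq: "K = K1 + K2"
      have "\<bar>sum_mset K2\<bar> \<le> int (size K2) * int R"
        using K(2) eq by (intro abs_sum_mset_le) auto
      also have "\<dots> \<le> int m * int R" using K(1) eq by (intro mult_right_mono) auto
      finally show "sum_mset K2 \<le> int (m * R)" by simp
    qed
  qed
  define T where "T = {K1. K1 \<subseteq># K} \<times> {ps. set ps \<subseteq> {1..int (m * R)} \<and> length ps = k - 1}"
  \<comment> \<open>Covers all contributing pairs: the missing entry of P is recovered from its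
    prescribed sum.\<close>
  define F where "F = (\<lambda>(K1, ps). let P = mset ((s K1 (K - K1) - sum_list ps) # ps) in (K1 + P, (K - K1) + reflect P))"
  have decomp: "\<exists>K1 K2 P. M = K1 + P \<and> N = K2 + reflect P \<and> K = K1 + K2 \<and> size P = k \<and> (\<forall>a\<in>#P. 0 < a)
      \<and> sum_mset P = s K1 K2" if "h (M, N) \<noteq> 0" for M N
  proof -
    from that have nz: "f M \<noteq> 0" "g N \<noteq> 0" "star_coeff M N K k \<noteq> 0" by (auto simp: h_def)
    from nz(3) obtain P K1 K2 where P: "M = K1 + P" "N = K2 + reflect P" "K = K1 + K2" "size P = k" "\<forall>a\<in>#P. 0 < a"
      by (rule star_coeff_contraction)
    moreover have "sum_mset P = s K1 K2" using nz(1,2) P by (intro s) auto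
    ultimately show ?thesis by blast
  qed
  have sub: "{x. h x \<noteq> 0} \<subseteq> F ` T"
  proof
    fix x assume x: "x \<in> {x. h x \<noteq> 0}"
    obtain M N where MN: "x = (M, N)" by (cases x)
    with x decomp obtain K1 K2 P where P: "M = K1 + P" "N = K2 + reflect P" "K = K1 + K2" "size P = k" "\<forall>a\<in>#P. 0 < a"
      "sum_mset P = s K1 K2" by blast
    obtain ps where ps: "mset ps = P" by (metis ex_mset)
    with P(4) k obtain p qs where "ps = p # qs" by (cases ps) auto
    with ps P(4) have P': "P = mset (p # qs)" "length qs = k - 1" by auto
    have "p = s K1 (K - K1) - sum_list qs" using P(3,6) P'(1) by (simp add: sum_mset_sum_list)
    moreover have "b \<in> {1..int (m * R)}" if "b \<in> set qs" for b
      using P(5) that P'(1) member_le_sum_mset[of P b] s_le[OF P(3)] P(6) by force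
    ultimately show "x \<in> F ` T"
      unfolding F_def T_def MN using P P'
      by (intro image_eqI[of _ _ "(K1, qs)"]) (auto simp: Let_def)
  qed
  have finT: "finite T" unfolding T_def using finite_card_submultisets[of K]
    by (intro finite_cartesian_product finite_lists_length_eq) auto
  have "card {ps. set ps \<subseteq> {1..int (m * R)} \<and> length ps = k - 1} = (m * R) ^ (k - 1)"
    by (subst card_lists_length_eq) (auto simp: nat_mult_distrib)
  also have "\<dots> \<le> (Suc m * R) ^ (k - 1)" by (intro power_mono) auto
  finally have "card T \<le> 2 ^ m * (Suc m * R) ^ (k - 1)"
    unfolding T_def card_cartesian_product
    using finite_card_submultisets[of K] power_increasing[OF K(1), of "2::nat"]
    by (intro mult_mono) (auto intro: order_trans)
  from of_nat_mono[OF this, where 'a = real] have cardT: "real (card T) \<le> 2 ^ m * ?c"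
    by simp
  have le: "norm (h x) \<le> ?B" for x
  proof (cases "h x = 0")
    case True
    with B0 show ?thesis by simp
  next
    case False
    obtain M N where x: "x = (M, N)" by (cases x)
    with False decomp obtain K1 K2 P where P: "M = K1 + P" "N = K2 + reflect P" "K = K1 + K2" "size P = k" "\<forall>a\<in>#P. 0 < a"
      "sum_mset P = s K1 K2" by blast
    have P_le: "\<bar>b\<bar> \<le> int (Suc m * R)" if "b \<in># P" for b
    proof -
      have "b \<le> int (m * R)" using member_le_sum_mset[OF P(5) that] s_le[OF P(3)] P(6) by simp
      moreover have "int (m * R) \<le> int (Suc m * R)" by simp
      ultimately show ?thesis using P(5) that by force
    qed
    have K_le: "\<bar>b\<bar> \<le> int (Suc m * R)" if "b \<in># K" for b
      using K(2) that by (fastforce intro: order_trans)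
    have M: "size M \<le> m + k" "\<forall>a\<in>#M. \<bar>a\<bar> \<le> int (Suc m * R)"
      using P K(1) P_le K_le by auto
    have N: "size N \<le> m + k" "\<forall>a\<in>#N. \<bar>a\<bar> \<le> int (Suc m * R)"
      using P K(1) P_le K_le by auto
    have "norm (star_coeff M N K k) \<le> 2 ^ size M * (real (2 * (m + k)) * real (Suc m * R)) ^ k"
    proof (rule norm_star_coeff_le)
      show "\<forall>a\<in>#M. real_of_int \<bar>a\<bar> \<le> real (Suc m * R)"
        using M(2) by (metis of_int_le_iff of_int_of_nat_eq)
    qed (use M N in auto)
    also have "\<dots> \<le> 2 ^ (m + k) * (real (2 * (m + k)) * real (Suc m * R)) ^ k"
      using M(1) by (intro mult_right_mono power_increasing) auto
    finally show ?thesis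
      unfolding h_def x prod.case norm_mult
      using f[OF M] g[OF N] B by (intro mult_mono) auto
  qed
  have "contract f g K k = (\<Sum>x\<in>F ` T. h x)"
    unfolding contract_def h_def[symmetric] using finT sub by (intro Sum_any.expand_superset) auto
  also have "norm \<dots> \<le> (\<Sum>x\<in>F ` T. ?B)"
    by (rule sum_norm_le) (use le in blast)
  also have "\<dots> = real (card (F ` T)) * ?B" by simp
  also have "\<dots> \<le> real (card T) * ?B"
    using card_image_le[OF finT, of F] B0 by (intro mult_right_mono) auto
  also have "\<dots> \<le> 2 ^ m * ?c * ?B"
    using cardT B0 by (intro mult_right_mono)
  finally show ?thesis .
qed

lemma star_contract:
  "star f g K e r = (\<Sum>e1\<le>e. \<Sum>(r1, r2) | r1 + r2 \<le> r.
     contract (\<lambda>M. f M e1 r1) (\<lambda>N. g N (e - e1) r2) K (r - r1 - r2))"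
proof -
  have "{(r1, r2). r1 + r2 \<le> r} = Sigma {..r} (\<lambda>r1. {..r - r1})" by auto
  then show ?thesis
    by (simp add: star_def contract_def star_coeff_def sum.Sigma)
qed

text \<open>The reversed product is reindexed so that both orders of the same pair of coefficients
  sit together. The terms with r1 + r2 = r have no contraction and cancel, so every remaining term
  has at least one.\<close>

lemma star_commutator_contract:
  "star_commutator f g K e r = (\<Sum>e1\<le>e. \<Sum>(r1, r2) | r1 + r2 < r.
     contract (\<lambda>M. f M e1 r1) (\<lambda>N. g N (e - e1) r2) K (r - r1 - r2) -
     contract (\<lambda>M. g M (e - e1) r2) (\<lambda>N. f N e1 r1) K (r - r1 - r2))"
proof -
  let ?c1 = "\<lambda>e1 (r1, r2). contract (\<lambda>M. f M e1 r1) (\<lambda>N. g N (e - e1) r2) K (r - r1 - r2)"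
  let ?c2 = "\<lambda>e1 (r1, r2). contract (\<lambda>M. g M (e - e1) r2) (\<lambda>N. f N e1 r1) K (r - r1 - r2)"
  let ?c3 = "\<lambda>e1 (r1, r2). contract (\<lambda>M. g M e1 r1) (\<lambda>N. f N (e - e1) r2) K (r - r1 - r2)"
  have fin: "finite {(r1, r2). r1 + r2 \<le> r}"
    by (rule finite_subset[of _ "{..r} \<times> {..r}"]) auto
  have "star g f K e r = (\<Sum>e1\<le>e. \<Sum>p | fst p + snd p \<le> r. ?c3 e1 p)"
    by (simp add: star_contract case_prod_unfold)
  also have "\<dots> = (\<Sum>e1\<le>e. \<Sum>p | fst p + snd p \<le> r. ?c3 (e - e1) p)"
    by (rule sum.reindex_bij_witness[of _ "\<lambda>x. e - x" "\<lambda>x. e - x"]) auto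
  also have "\<dots> = (\<Sum>e1\<le>e. \<Sum>p | fst p + snd p \<le> r. ?c2 e1 p)"
  proof (rule sum.cong[OF refl])
    fix e1 assume "e1 \<in> {..e}"
    then show "(\<Sum>p | fst p + snd p \<le> r. ?c3 (e - e1) p) = (\<Sum>p | fst p + snd p \<le> r. ?c2 e1 p)"
      by (intro sum.reindex_bij_witness[of _ prod.swap prod.swap])
        (auto simp: add.commute diff_right_commute)
  qed
  finally have "star_commutator f g K e r = (\<Sum>e1\<le>e. \<Sum>p | fst p + snd p \<le> r. ?c1 e1 p - ?c2 e1 p)"
    by (simp add: star_commutator_def star_contract[of f] case_prod_unfold sum_subtractf)
  also have "\<dots> = (\<Sum>e1\<le>e. \<Sum>p | fst p + snd p < r. ?c1 e1 p - ?c2 e1 p)"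
  proof (intro sum.cong[OF refl] sum.mono_neutral_right ballI)
    show "finite {p. fst p + snd p \<le> r}" using fin by (simp add: case_prod_unfold)
  next
    fix e1 p assume "p \<in> {p. fst p + snd p \<le> r} - {p. fst p + snd p < r}"
    then have "r - fst p - snd p = 0" by auto
    then show "?c1 e1 p - ?c2 e1 p = 0"
      by (simp add: case_prod_unfold contract_0_commute)
  qed auto
  finally show ?thesis by (simp add: case_prod_unfold)
qed

section \<open>Graded Fourier series\<close>

text \<open>The constant may depend on the number of letters \<open>m\<close>, but not on the mode
  \<open>A\<close> or on \<open>R\<close>. All \<open>m\<close> are quantified because a term with k
  contractions and m free letters needs bounds on factors with up to m + k letters.\<close>

definition growth :: "nat \<Rightarrow> (int \<Rightarrow> int multiset \<Rightarrow> complex) \<Rightarrow> bool" where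
  "growth D f \<longleftrightarrow> (\<forall>m. \<exists>C. \<forall>A M. \<forall>R::nat. size M \<le> m \<longrightarrow> (\<forall>a\<in>#M. \<bar>a\<bar> \<le> int R) \<longrightarrow> 1 \<le> R \<longrightarrow>
     norm (f A M) \<le> C * real R ^ D)"

lemma growthI:
  assumes "\<And>m. \<exists>C. \<forall>A M. \<forall>R::nat. size M \<le> m \<longrightarrow> (\<forall>a\<in>#M. \<bar>a\<bar> \<le> int R) \<longrightarrow> 1 \<le> R \<longrightarrow>
     norm (f A M) \<le> C * real R ^ D"
  shows "growth D f"
  using assms unfolding growth_def by blast

lemma growthE:
  assumes "growth D f"
  obtains C where "C \<ge> 0"
    "\<And>A M R. size M \<le> m \<Longrightarrow> \<forall>a\<in>#M. \<bar>a\<bar> \<le> int R \<Longrightarrow> 1 \<le> R \<Longrightarrow> norm (f A M) \<le> C * real R ^ D"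
proof -
  obtain C where C: "\<And>A M R. size M \<le> m \<Longrightarrow> \<forall>a\<in>#M. \<bar>a\<bar> \<le> int R \<Longrightarrow> 1 \<le> R \<Longrightarrow> norm (f A M) \<le> C * real R ^ D"
    using assms unfolding growth_def by meson
  show ?thesis
  proof (rule that[of "\<bar>C\<bar>"])
    fix A M R assume "size M \<le> m" "\<forall>a\<in>#M. \<bar>a\<bar> \<le> int R" "1 \<le> R"
    from C[OF this] have "norm (f A M) \<le> C * real R ^ D" .
    also have "\<dots> \<le> \<bar>C\<bar> * real R ^ D" by (intro mult_right_mono) auto
    finally show "norm (f A M) \<le> \<bar>C\<bar> * real R ^ D" .
  qed simp
qed

lemma growth_0: "growth D (\<lambda>A M. 0)"
  by (rule growthI, rule exI[of _ 0]) simp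

lemma growth_add:
  assumes "growth D f" "growth D g"
  shows "growth D (\<lambda>A M. f A M + g A M)"
proof (rule growthI)
  fix m
  obtain C where C: "C \<ge> 0" "\<And>A M R. size M \<le> m \<Longrightarrow> \<forall>a\<in>#M. \<bar>a\<bar> \<le> int R \<Longrightarrow> 1 \<le> R \<Longrightarrow> norm (f A M) \<le> C * real R ^ D"
    by (rule growthE[OF assms(1), of m]) (rule that)
  obtain C' where C': "C' \<ge> 0" "\<And>A M R. size M \<le> m \<Longrightarrow> \<forall>a\<in>#M. \<bar>a\<bar> \<le> int R \<Longrightarrow> 1 \<le> R \<Longrightarrow> norm (g A M) \<le> C' * real R ^ D"
    by (rule growthE[OF assms(2), of m]) (rule that)
  have "norm (f A M + g A M) \<le> (C + C') * real R ^ D"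
    if *: "size M \<le> m" "\<forall>a\<in>#M. \<bar>a\<bar> \<le> int R" "1 \<le> R" for A M R
    unfolding distrib_right by (rule norm_triangle_mono[OF C(2)[OF *] C'(2)[OF *]])
  then show "\<exists>C. \<forall>A M. \<forall>R::nat. size M \<le> m \<longrightarrow> (\<forall>a\<in>#M. \<bar>a\<bar> \<le> int R) \<longrightarrow> 1 \<le> R \<longrightarrow>
     norm (f A M + g A M) \<le> C * real R ^ D" by blast
qed

lemma growth_sum: "(\<And>i. i \<in> I \<Longrightarrow> growth D (f i)) \<Longrightarrow> growth D (\<lambda>A M. \<Sum>i\<in>I. f i A M)"
  by (induction I rule: infinite_finite_induct) (auto simp: growth_0 growth_add)

lemma growth_cmult:
  assumes "growth D f"
  shows "growth D (\<lambda>A M. c * f A M)"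
proof (rule growthI)
  fix m
  obtain C where C: "C \<ge> 0" "\<And>A M R. size M \<le> m \<Longrightarrow> \<forall>a\<in>#M. \<bar>a\<bar> \<le> int R \<Longrightarrow> 1 \<le> R \<Longrightarrow> norm (f A M) \<le> C * real R ^ D"
    by (rule growthE[OF assms, of m]) (rule that)
  have "norm (c * f A M) \<le> (norm c * C) * real R ^ D"
    if *: "size M \<le> m" "\<forall>a\<in>#M. \<bar>a\<bar> \<le> int R" "1 \<le> R" for A M R
    unfolding norm_mult mult.assoc by (rule mult_left_mono[OF C(2)[OF *]]) simp
  then show "\<exists>C. \<forall>A M. \<forall>R::nat. size M \<le> m \<longrightarrow> (\<forall>a\<in>#M. \<bar>a\<bar> \<le> int R) \<longrightarrow> 1 \<le> R \<longrightarrow>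
     norm (c * f A M) \<le> C * real R ^ D" by blast
qed

lemma growth_diff: "growth D f \<Longrightarrow> growth D g \<Longrightarrow> growth D (\<lambda>A M. f A M - g A M)"
  using growth_add[of D f "\<lambda>A M. - 1 * g A M"] growth_cmult[of D g "-1"] by simp

lemma growth_mono:
  assumes "growth D f" "D \<le> D'"
  shows "growth D' f"
proof (rule growthI)
  fix m
  obtain C where C: "C \<ge> 0" "\<And>A M R. size M \<le> m \<Longrightarrow> \<forall>a\<in>#M. \<bar>a\<bar> \<le> int R \<Longrightarrow> 1 \<le> R \<Longrightarrow> norm (f A M) \<le> C * real R ^ D"
    by (rule growthE[OF assms(1), of m]) (rule that)
  have "norm (f A M) \<le> C * real R ^ D'" if *: "size M \<le> m" "\<forall>a\<in>#M. \<bar>a\<bar> \<le> int R" "1 \<le> R" for A M R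
  proof -
    have "C * real R ^ D \<le> C * real R ^ D'"
      using C(1) assms(2) *(3) by (intro mult_left_mono power_increasing) auto
    with C(2)[OF *] show ?thesis by (rule order_trans)
  qed
  then show "\<exists>C. \<forall>A M. \<forall>R::nat. size M \<le> m \<longrightarrow> (\<forall>a\<in>#M. \<bar>a\<bar> \<le> int R) \<longrightarrow> 1 \<le> R \<longrightarrow>
     norm (f A M) \<le> C * real R ^ D'" by blast
qed

lemma growth_contract:
  assumes F: "growth D1 F" and G: "growth D2 G" and k: "k \<ge> 1"
    and zero: "\<And>A. (\<forall>M. F A M \<noteq> 0 \<longrightarrow> sum_mset M = 0) \<or> (\<forall>N. G A N \<noteq> 0 \<longrightarrow> sum_mset N = 0)"
  shows "growth (D1 + D2 + 2 * k - 1) (\<lambda>A K. contract (F A) (G A) K k)"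
proof (rule growthI)
  fix m
  obtain C1 where C1: "C1 \<ge> 0" "\<And>A M R. size M \<le> m + k \<Longrightarrow> \<forall>a\<in>#M. \<bar>a\<bar> \<le> int R \<Longrightarrow> 1 \<le> R \<Longrightarrow> norm (F A M) \<le> C1 * real R ^ D1"
    by (rule growthE[OF F, of "m + k"]) (rule that)
  obtain C2 where C2: "C2 \<ge> 0" "\<And>A M R. size M \<le> m + k \<Longrightarrow> \<forall>a\<in>#M. \<bar>a\<bar> \<le> int R \<Longrightarrow> 1 \<le> R \<Longrightarrow> norm (G A M) \<le> C2 * real R ^ D2"
    by (rule growthE[OF G, of "m + k"]) (rule that)
  define E where "E = 2 ^ m * real (Suc m) ^ (k - 1) * (C1 * real (Suc m) ^ D1 * (C2 * real (Suc m) ^ D2) *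
    (2 ^ (m + k) * (real (2 * (m + k)) * real (Suc m)) ^ k))"
  have "norm (contract (F A) (G A) K k) \<le> E * real R ^ (D1 + D2 + 2 * k - 1)"
    if K: "size K \<le> m" "\<forall>a\<in>#K. \<bar>a\<bar> \<le> int R" "1 \<le> R" for A K R
  proof -
    have R: "1 \<le> Suc m * R" using K(3) by simp
    have "norm (contract (F A) (G A) K k) \<le>
      2 ^ m * real (Suc m * R) ^ (k - 1) * (C1 * real (Suc m * R) ^ D1 * (C2 * real (Suc m * R) ^ D2) *
      (2 ^ (m + k) * (real (2 * (m + k)) * real (Suc m * R)) ^ k))"
      by (rule contract_bound[OF K(1,2) k _ _ zero C1(2)[OF _ _ R] C2(2)[OF _ _ R]])
        (use C1(1) C2(1) in simp_all)
    also have "\<dots> = E * (real R ^ (k - 1) * real R ^ D1 * real R ^ D2 * real R ^ k)"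
      unfolding E_def of_nat_mult power_mult_distrib by (simp only: ac_simps)
    also have "real R ^ (k - 1) * real R ^ D1 * real R ^ D2 * real R ^ k = real R ^ (D1 + D2 + 2 * k - 1)"
      using k unfolding power_add[symmetric] by (intro arg_cong[of _ _ "power (real R)"]) simp
    finally show ?thesis .
  qed
  then show "\<exists>C. \<forall>A M. \<forall>R::nat. size M \<le> m \<longrightarrow> (\<forall>a\<in>#M. \<bar>a\<bar> \<le> int R) \<longrightarrow> 1 \<le> R \<longrightarrow>
     norm (contract (F A) (G A) M k) \<le> C * real R ^ (D1 + D2 + 2 * k - 1)" by blast
qed

text \<open>For e = 2l and r = g - l the weight is 2(2g - l + size M), twice the dimension count of
  the intersection numbers, and 2r + e is 2g. Thus \<open>c\<close> measures the excess of growth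
  over the degree of the DR polynomials.\<close>

definition graded :: "int \<Rightarrow> nat \<Rightarrow> complex \<Rightarrow> fourier \<Rightarrow> bool" where
  "graded w c s \<phi> \<longleftrightarrow>
     (\<forall>A M e r. \<phi> A M e r \<noteq> 0 \<longrightarrow> sum_mset M = A \<and> int (4 * r + e + 2 * size M) = w) \<and>
     (\<forall>A M e r. \<phi> (- A) (reflect M) e r = s * \<phi> A M e r) \<and>
     (\<forall>e r. growth (2 * r + e + c) (\<lambda>A M. \<phi> A M e r))"

lemma gradedD:
  assumes "graded w c s \<phi>"
  shows "\<phi> A M e r \<noteq> 0 \<Longrightarrow> sum_mset M = A" "\<phi> A M e r \<noteq> 0 \<Longrightarrow> int (4 * r + e + 2 * size M) = w"
    "\<phi> (- A) (reflect M) e r = s * \<phi> A M e r" "growth (2 * r + e + c) (\<lambda>A M. \<phi> A M e r)"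
  using assms unfolding graded_def by blast+

lemma growth_fixed_mode: "growth D \<phi> \<Longrightarrow> growth D (\<lambda>A M. \<phi> (0::int) M)"
  unfolding growth_def by meson

text \<open>A contraction removes two letters and adds one \<hbar>, which leaves the weight alone;
  the -4 is the division by \<hbar>. With k contractions r + 1 = r1 + r2 + k, so the exponent 2k - 1
  is the 2(r - r1 - r2) accounted for by \<hbar> plus an excess of 1.\<close>

lemma graded_commutator:
  assumes \<phi>: "graded w1 c1 s1 \<phi>" and \<psi>: "graded w2 c2 s2 \<psi>"
  shows "graded (w1 + w2 - 4) (c1 + c2 + 1) (- (s1 * s2))
    (fourier_div_hbar (fourier_commutator \<phi> (integral_S1 \<psi>)))"
proof -
  define c1' where "c1' A K e r e1 p = contract (\<lambda>M. \<phi> A M e1 (fst p)) (\<lambda>N. \<psi> 0 N (e - e1) (snd p)) K (Suc r - fst p - snd p)"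
    for A K e r e1 p
  define c2' where "c2' A K e r e1 p = contract (\<lambda>M. \<psi> 0 M (e - e1) (snd p)) (\<lambda>N. \<phi> A N e1 (fst p)) K (Suc r - fst p - snd p)"
    for A K e r e1 p
  let ?\<chi> = "fourier_div_hbar (fourier_commutator \<phi> (integral_S1 \<psi>))"
  have eq: "?\<chi> A K e r = (\<Sum>e1\<le>e. \<Sum>p | fst p + snd p < Suc r. c1' A K e r e1 p - c2' A K e r e1 p)" for A K e r
    by (simp add: fourier_div_hbar_def fourier_commutator_def integral_S1_def div_hbar_def
        star_commutator_contract c1'_def c2'_def case_prod_unfold)
  show ?thesis
    unfolding graded_def
  proof (intro conjI allI impI)
    fix A K e r assume "?\<chi> A K e r \<noteq> 0"
    from this[unfolded eq] obtain e1 where "e1 \<in> {..e}"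
      and sum: "(\<Sum>p | fst p + snd p < Suc r. c1' A K e r e1 p - c2' A K e r e1 p) \<noteq> 0"
      by (rule sum.not_neutral_contains_not_neutral)
    then have e1: "e1 \<le> e" by simp
    from sum obtain p where "p \<in> {p. fst p + snd p < Suc r}" and "c1' A K e r e1 p - c2' A K e r e1 p \<noteq> 0"
      by (rule sum.not_neutral_contains_not_neutral)
    then have p: "fst p + snd p < Suc r" "c1' A K e r e1 p - c2' A K e r e1 p \<noteq> 0" by simp_all
    let ?k = "Suc r - fst p - snd p"
    from p(2) have "c1' A K e r e1 p \<noteq> 0 \<or> c2' A K e r e1 p \<noteq> 0" by auto
    then obtain M N P K1 K2 where M: "\<phi> A M e1 (fst p) \<noteq> 0" and N: "\<psi> 0 N (e - e1) (snd p) \<noteq> 0"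
      and P: "K = K1 + K2" "size P = ?k" "M = K1 + P \<and> N = K2 + reflect P \<or> N = K1 + P \<and> M = K2 + reflect P"
    proof (elim disjE)
      assume "c1' A K e r e1 p \<noteq> 0"
      then obtain M N where 1: "\<phi> A M e1 (fst p) \<noteq> 0" "\<psi> 0 N (e - e1) (snd p) \<noteq> 0" "star_coeff M N K ?k \<noteq> 0"
        unfolding c1'_def by (rule contract_nonzero)
      from 1(3) obtain P K1 K2 where "M = K1 + P" "N = K2 + reflect P" "K = K1 + K2" "size P = ?k"
        by (rule star_coeff_contraction)
      with 1 show ?thesis by (intro that) auto
    next
      assume "c2' A K e r e1 p \<noteq> 0"
      then obtain N M where 1: "\<psi> 0 N (e - e1) (snd p) \<noteq> 0" "\<phi> A M e1 (fst p) \<noteq> 0" "star_coeff N M K ?k \<noteq> 0"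
        unfolding c2'_def by (rule contract_nonzero)
      from 1(3) obtain P K1 K2 where "N = K1 + P" "M = K2 + reflect P" "K = K1 + K2" "size P = ?k"
        by (rule star_coeff_contraction)
      with 1 show ?thesis by (intro that) auto
    qed
    have "sum_mset M = A" "sum_mset N = 0" "int (4 * fst p + e1 + 2 * size M) = w1"
       "int (4 * snd p + (e - e1) + 2 * size N) = w2"
      using gradedD(1,2)[OF \<phi> M] gradedD(1,2)[OF \<psi> N] by auto
    then show "sum_mset K = A" "int (4 * r + e + 2 * size K) = w1 + w2 - 4"
      using P p(1) e1 by (auto simp: sum_mset_reflect)
  next
    fix A K e r
    have \<psi>0: "\<psi> 0 (reflect M) e r = s2 * \<psi> 0 M e r" for M e r
      using gradedD(3)[OF \<psi>, of 0] by simp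
    have "c1' (- A) (reflect K) e r e1 p = s1 * s2 * c2' A K e r e1 p" for e1 p
      unfolding c1'_def c2'_def by (rule contract_reflect) (rule gradedD(3)[OF \<phi>] \<psi>0)+
    moreover have "c2' (- A) (reflect K) e r e1 p = s1 * s2 * c1' A K e r e1 p" for e1 p
      unfolding c1'_def c2'_def mult.commute[of s1 s2]
      by (rule contract_reflect) (rule gradedD(3)[OF \<phi>] \<psi>0)+
    ultimately show "?\<chi> (- A) (reflect K) e r = - (s1 * s2) * ?\<chi> A K e r"
      unfolding eq sum_distrib_left by (simp add: algebra_simps)
  next
    fix e r
    have "growth (2 * r + e + (c1 + c2 + 1)) (\<lambda>A K. c1' A K e r e1 p - c2' A K e r e1 p)"
      if p: "fst p + snd p < Suc r" and e1: "e1 \<le> e" for e1 p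
    proof -
      let ?k = "Suc r - fst p - snd p"
      let ?F = "\<lambda>A M. \<phi> A M e1 (fst p)" and ?G = "\<lambda>A N. \<psi> 0 N (e - e1) (snd p)"
      have F: "growth (2 * fst p + e1 + c1) ?F" and G: "growth (2 * snd p + (e - e1) + c2) ?G"
        using gradedD(4)[OF \<phi>] growth_fixed_mode[OF gradedD(4)[OF \<psi>]] by simp_all
      have k: "?k \<ge> 1" using p by simp
      have zero: "\<forall>N. ?G A N \<noteq> 0 \<longrightarrow> sum_mset N = 0" for A
        using gradedD(1)[OF \<psi>, of 0] by blast
      have exps: "(2 * fst p + e1 + c1) + (2 * snd p + (e - e1) + c2) + 2 * ?k - 1 = 2 * r + e + (c1 + c2 + 1)"
        "(2 * snd p + (e - e1) + c2) + (2 * fst p + e1 + c1) + 2 * ?k - 1 = 2 * r + e + (c1 + c2 + 1)"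
        using p e1 by auto
      show ?thesis
        unfolding c1'_def c2'_def
        using growth_contract[OF F G k disjI2[OF zero]] growth_contract[OF G F k disjI1[OF zero]]
        unfolding exps by (rule growth_diff)
    qed
    then show "growth (2 * r + e + (c1 + c2 + 1)) (\<lambda>A K. ?\<chi> A K e r)"
      unfolding eq by (intro growth_sum) auto
  qed
qed

section \<open>The Hamiltonians\<close>

lemma sum_list_map_uminus: "sum_list (map uminus as) = - sum_list (as :: int list)"
  by (induction as) auto

lemma even_polynomial_uminus:
  assumes "even_polynomial_on_sum_zero n D f" "length as = n" "sum_list as = 0"
  shows "f (map uminus as) = f as"
proof -
  obtain c where c: "\<And>as. length as = n \<Longrightarrow> sum_list as = 0 \<Longrightarrow>
    f as = (\<Sum>es | length es = n \<and> sum_list es \<le> D \<and> even (sum_list es).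
                  c es * (\<Prod>j<n. of_int (as ! j) ^ (es ! j)))"
    using assms(1) unfolding even_polynomial_on_sum_zero_def by blast
  have "(\<Prod>j<n. real_of_int (map uminus as ! j) ^ (es ! j)) = (\<Prod>j<n. of_int (as ! j) ^ (es ! j))"
    if es: "length es = n" "even (sum_list es)" for es
  proof -
    have "(\<Prod>j<n. real_of_int (map uminus as ! j) ^ (es ! j)) = (\<Prod>j<n. (-1) ^ (es ! j) * of_int (as ! j) ^ (es ! j))"
      using assms(2) by (intro prod.cong) (auto simp flip: power_mult_distrib)
    also have "\<dots> = (-1) ^ (\<Sum>j<n. es ! j) * (\<Prod>j<n. of_int (as ! j) ^ (es ! j))"
      by (simp add: prod.distrib power_sum)
    also have "(\<Sum>j<n. es ! j) = sum_list es"
      using es(1) by (simp add: sum_list_sum_nth atLeast0LessThan)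
    finally show ?thesis using es(2) by simp
  qed
  moreover have "sum_list (map uminus as) = 0" using assms(3) by (simp add: sum_list_map_uminus)
  ultimately show ?thesis using assms(2,3) by (simp add: c)
qed

lemma even_polynomial_bound:
  assumes "even_polynomial_on_sum_zero n D f"
  obtains C where "C \<ge> 0"
    "\<And>as R. length as = n \<Longrightarrow> sum_list as = 0 \<Longrightarrow> \<forall>a\<in>set as. \<bar>a\<bar> \<le> int R \<Longrightarrow> 1 \<le> R \<Longrightarrow> \<bar>f as\<bar> \<le> C * real R ^ D"
proof -
  obtain c where c: "\<And>as. length as = n \<Longrightarrow> sum_list as = 0 \<Longrightarrow>
    f as = (\<Sum>es | length es = n \<and> sum_list es \<le> D \<and> even (sum_list es).
                  c es * (\<Prod>j<n. of_int (as ! j) ^ (es ! j)))"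
    using assms(1) unfolding even_polynomial_on_sum_zero_def by blast
  let ?S = "{es. length es = n \<and> sum_list es \<le> D \<and> even (sum_list es)}"
  show ?thesis
  proof (rule that[of "\<Sum>es\<in>?S. \<bar>c es\<bar>"])
    fix as and R :: nat
    assume as: "length as = n" "sum_list as = 0" "\<forall>a\<in>set as. \<bar>a\<bar> \<le> int R" and R: "1 \<le> R"
    have "\<bar>\<Prod>j<n. real_of_int (as ! j) ^ (es ! j)\<bar> \<le> real R ^ D" if es: "es \<in> ?S" for es
    proof -
      have "\<bar>\<Prod>j<n. real_of_int (as ! j) ^ (es ! j)\<bar> = (\<Prod>j<n. \<bar>real_of_int (as ! j)\<bar> ^ (es ! j))"
        by (simp add: abs_prod power_abs)
      also have "\<dots> \<le> (\<Prod>j<n. real R ^ (es ! j))"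
      proof (intro prod_mono conjI power_mono)
        fix j assume "j \<in> {..<n}"
        then have "\<bar>as ! j\<bar> \<le> int R" using as by simp
        then show "\<bar>real_of_int (as ! j)\<bar> \<le> real R" by linarith
      qed auto
      also have "\<dots> = real R ^ sum_list es"
        using es by (simp add: sum_list_sum_nth atLeast0LessThan power_sum)
      also have "\<dots> \<le> real R ^ D" using es R by (intro power_increasing) auto
      finally show ?thesis .
    qed
    then have "norm (f as) \<le> (\<Sum>es\<in>?S. \<bar>c es\<bar> * real R ^ D)"
      unfolding c[OF as(1,2)] by (intro sum_norm_le) (simp add: abs_mult mult_left_mono)
    then show "\<bar>f as\<bar> \<le> (\<Sum>es\<in>?S. \<bar>c es\<bar>) * real R ^ D"
      by (simp add: sum_distrib_right)
  qed (simp add: sum_nonneg)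
qed

lemma card_lists_mset: "finite {as. mset as = M}" "card {as. mset as = M} \<le> fact (size M)"
proof -
  show "finite {as. mset as = M}"
    using finite_permutations_of_multiset[of M] by (simp add: permutations_of_multiset_def)
  have "card {as. mset as = M} = card (permutations_of_multiset M)"
    by (simp add: permutations_of_multiset_def)
  also have "\<dots> = fact (size M) div (\<Prod>x\<in>set_mset M. fact (count M x))"
    by (rule card_permutations_of_multiset)
  also have "\<dots> \<le> fact (size M)" by simp
  finally show "card {as. mset as = M} \<le> fact (size M)" .
qed

context dr_geometry
begin

lemma psi_lam_mem:
  assumes "2 * g + n > 2" "1 \<le> n" "j \<le> g"
  shows "psi G g n 1 ^ k * lam G g n j \<in> coh G g n (k + j) \<inter> taut G g n"
proof -
  have "psi G g n 1 ^ k \<in> coh G g n k \<inter> taut G g n"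
  proof (induction k)
    case 0
    then show ?case using coh_one taut_one assms(1) by simp
  next
    case (Suc k)
    then show ?case
      using psi[OF assms(1), of 1] assms(2) coh_mult[OF assms(1), of _ 1 _ k] taut_mult[OF assms(1)] by auto
  qed
  then show ?thesis
    using lam[OF assms(1,3)] coh_mult[OF assms(1)] taut_mult[OF assms(1)] by auto
qed

text \<open>The class has degree d + 1 + j and the curves carry two marked points besides those of
  \<open>as\<close>. The bound d \<ge> -1 keeps \<open>nat (d + 1)\<close> from truncating.\<close>

lemma DR_integral_degree:
  assumes "2 * g + length as > 0" "j \<le> g" "d \<ge> - 1" "DR_integral G g d j as \<noteq> 0"
  shows "d + 2 + int j = 2 * int g + int (length as)"
proof -
  have "2 * g + length (0 # as @ [- sum_list as]) > 2" using assms(1) by simp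
  moreover have "sum_list (0 # as @ [- sum_list as]) = 0" by simp
  moreover have "psi G g (length as + 2) 1 ^ nat (d + 1) * lam G g (length as + 2) j
      \<in> coh G g (length (0 # as @ [- sum_list as])) (nat (d + 1) + j)"
    using psi_lam_mem[of g "length as + 2" j "nat (d + 1)"] assms(1,2) by simp
  ultimately have "int (nat (d + 1) + j) = 2 * int g - 3 + int (length (0 # as @ [- sum_list as]))"
    using DR_degree assms(4) unfolding DR_integral_def by blast
  then show ?thesis using assms(3) by simp
qed

lemma DR_integral_even_polynomial:
  assumes "2 * g + n > 0" "j \<le> g"
  shows "even_polynomial_on_sum_zero (n + 2) (2 * g)
    (\<lambda>as. DR G g as (psi G g (n + 2) 1 ^ k * lam G g (n + 2) j))"
  using assms psi_lam_mem[of g "n + 2" j k] by (intro DR_even_polynomial) auto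

lemma DR_integral_uminus:
  assumes "2 * g + length as > 0" "j \<le> g"
  shows "DR_integral G g d j (map uminus as) = DR_integral G g d j as"
proof -
  have "map uminus (0 # as @ [- sum_list as]) = 0 # map uminus as @ [- sum_list (map uminus as)]"
    by (simp add: sum_list_map_uminus)
  then show ?thesis
    using even_polynomial_uminus[OF DR_integral_even_polynomial[OF assms, of "nat (d + 1)"], of "0 # as @ [- sum_list as]"]
    by (simp add: DR_integral_def)
qed

text \<open>The last entry of the cycle is minus the sum of the others, so the polynomial is
  evaluated at entries of size up to \<open>Suc n * R\<close>; the power of \<open>Suc n\<close>
  goes into the constant.\<close>

lemma DR_integral_bound:
  assumes "2 * g + n > 0" "j \<le> g"
  obtains C where "C \<ge> 0" "\<And>as R. length as = n \<Longrightarrow> \<forall>a\<in>set as. \<bar>a\<bar> \<le> int R \<Longrightarrow> 1 \<le> R \<Longrightarrow>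
    \<bar>DR_integral G g d j as\<bar> \<le> C * real R ^ (2 * g)"
proof -
  obtain C where C: "C \<ge> 0" "\<And>as R. length as = n + 2 \<Longrightarrow> sum_list as = 0 \<Longrightarrow> \<forall>a\<in>set as. \<bar>a\<bar> \<le> int R \<Longrightarrow> 1 \<le> R \<Longrightarrow>
    \<bar>DR G g as (psi G g (n + 2) 1 ^ nat (d + 1) * lam G g (n + 2) j)\<bar> \<le> C * real R ^ (2 * g)"
    by (rule even_polynomial_bound[OF DR_integral_even_polynomial[OF assms, of "nat (d + 1)"]]) (rule that)
  show ?thesis
  proof (rule that[of "C * real (Suc n) ^ (2 * g)"])
    fix as and R :: nat
    assume as: "length as = n" "\<forall>a\<in>set as. \<bar>a\<bar> \<le> int R" and R: "1 \<le> R"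
    have "\<bar>sum_list as\<bar> \<le> int n * int R"
      using abs_sum_mset_le[of "mset as" "int R"] as by (simp add: sum_mset_sum_list)
    also have "\<dots> \<le> int (Suc n * R)" by simp
    finally have "\<bar>sum_list as\<bar> \<le> int (Suc n * R)" .
    moreover have "\<bar>a\<bar> \<le> int (Suc n * R)" if "a \<in> set as" for a
      using as(2) that by (fastforce intro: order_trans)
    ultimately have "\<forall>a\<in>set (0 # as @ [- sum_list as]). \<bar>a\<bar> \<le> int (Suc n * R)" by auto
    moreover have "1 \<le> Suc n * R" using R by simp
    moreover have "length (0 # as @ [- sum_list as]) = n + 2" "sum_list (0 # as @ [- sum_list as]) = 0"
      using as by simp_all
    ultimately have "\<bar>DR G g (0 # as @ [- sum_list as]) (psi G g (n + 2) 1 ^ nat (d + 1) * lam G g (n + 2) j)\<bar>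
        \<le> C * real (Suc n * R) ^ (2 * g)"
      by (intro C(2))
    then show "\<bar>DR_integral G g d j as\<bar> \<le> C * real (Suc n) ^ (2 * g) * real R ^ (2 * g)"
      unfolding DR_integral_def as(1) of_nat_mult power_mult_distrib by (simp only: mult.assoc)
  qed (use C(1) in simp)
qed

lemma graded_Ham:
  assumes d: "d \<ge> - 1"
  shows "graded (2 * (d + 2)) 0 1 (Ham G d)"
  unfolding graded_def
proof (intro conjI allI impI)
  fix A M and e r :: nat assume nz: "Ham G d A M e r \<noteq> 0"
  let ?j = "e div 2" let ?g = "r + ?j"
  from nz have e: "even e" "2 * ?g + size M > 0" and A: "sum_mset M = A"
    and "(\<Sum>as | mset as = M. complex_of_real (DR_integral G ?g d ?j as)) \<noteq> 0"
    by (auto simp: Ham_def Let_def split: if_splits)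
  from this(4) obtain as where "as \<in> {as. mset as = M}" "complex_of_real (DR_integral G ?g d ?j as) \<noteq> 0"
    by (rule sum.not_neutral_contains_not_neutral)
  then have as: "mset as = M" "DR_integral G ?g d ?j as \<noteq> 0" by auto
  then have "d + 2 + int ?j = 2 * int ?g + int (size M)"
    using DR_integral_degree[OF _ _ d as(2)] e by auto
  with A e show "sum_mset M = A" "int (4 * r + e + 2 * size M) = 2 * (d + 2)"
    by (auto elim!: evenE)
next
  fix A M and e r :: nat
  let ?j = "e div 2" let ?g = "r + ?j"
  have "(\<Sum>as | mset as = reflect M. complex_of_real (DR_integral G ?g d ?j as)) =
     (\<Sum>as | mset as = M. complex_of_real (DR_integral G ?g d ?j as))" if "2 * ?g + size M > 0"
  proof (rule sum.reindex_bij_witness[of _ "map uminus" "map uminus"])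
    fix as assume "as \<in> {as. mset as = reflect M}"
    then have "mset as = reflect M" by simp
    then have "length as = size M" by (metis size_image_mset size_mset)
    with that show "complex_of_real (DR_integral G ?g d ?j (map uminus as)) = complex_of_real (DR_integral G ?g d ?j as)"
      by (simp add: DR_integral_uminus)
  qed (auto simp: comp_def)
  then show "Ham G d (- A) (reflect M) e r = 1 * Ham G d A M e r"
    by (auto simp: Ham_def Let_def sum_mset_reflect)
next
  fix e r :: nat
  let ?j = "e div 2" let ?g = "r + ?j"
  show "growth (2 * r + e + 0) (\<lambda>A M. Ham G d A M e r)"
  proof (rule growthI)
    fix m
    \<comment> \<open>The guard 2g + n > 0 sets aside the unstable case, in which \<open>Ham\<close>
      is 0 by definition.\<close>
    have "\<exists>C. C \<ge> 0 \<and> (\<forall>as. \<forall>R::nat. length as = n \<longrightarrow> (\<forall>a\<in>set as. \<bar>a\<bar> \<le> int R) \<longrightarrow> 1 \<le> R \<longrightarrow>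
      2 * ?g + n > 0 \<longrightarrow> \<bar>DR_integral G ?g d ?j as\<bar> \<le> C * real R ^ (2 * ?g))" for n
    proof (cases "2 * ?g + n > 0")
      case True
      obtain C where "C \<ge> 0" "\<And>as R. length as = n \<Longrightarrow> \<forall>a\<in>set as. \<bar>a\<bar> \<le> int R \<Longrightarrow> 1 \<le> R \<Longrightarrow>
          \<bar>DR_integral G ?g d ?j as\<bar> \<le> C * real R ^ (2 * ?g)"
        by (rule DR_integral_bound[OF True, of ?j d]) (simp, rule that)
      then show ?thesis by blast
    qed auto
    then obtain C where C0: "\<And>n. C n \<ge> 0" and C: "\<And>n as R. length as = n \<Longrightarrow> \<forall>a\<in>set as. \<bar>a\<bar> \<le> int R \<Longrightarrow> 1 \<le> R \<Longrightarrow>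
      2 * ?g + n > 0 \<Longrightarrow> \<bar>DR_integral G ?g d ?j as\<bar> \<le> C n * real R ^ (2 * ?g)"
      by metis
    let ?B = "\<Sum>n\<le>m. C n"
    have B0: "?B \<ge> 0" using C0 by (simp add: sum_nonneg)
    have "norm (Ham G d A M e r) \<le> ?B * real R ^ (2 * r + e + 0)"
      if M: "size M \<le> m" "\<forall>a\<in>#M. \<bar>a\<bar> \<le> int R" "1 \<le> R" for A M R
    proof (cases "even e \<and> 2 * ?g + size M > 0 \<and> sum_mset M = A")
      case True
      then have ge: "2 * ?g = 2 * r + e" by (auto elim!: evenE)
      have DR: "norm (complex_of_real (DR_integral G ?g d ?j as)) \<le> C (size M) * real R ^ (2 * ?g)" if "mset as = M" for as
        using C[of as "size M" R] M True that by (auto simp: norm_of_real)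
      have "norm (\<Sum>as | mset as = M. complex_of_real (DR_integral G ?g d ?j as)) \<le> (\<Sum>as | mset as = M. C (size M) * real R ^ (2 * ?g))"
        using DR by (intro sum_norm_le) auto
      also have "\<dots> = real (card {as. mset as = M}) * (C (size M) * real R ^ (2 * ?g))" by simp
      also have "\<dots> \<le> fact (size M) * (C (size M) * real R ^ (2 * ?g))"
        using of_nat_mono[OF card_lists_mset(2)[of M], where 'a = real] C0 by (intro mult_right_mono) simp_all
      finally have *: "norm (\<Sum>as | mset as = M. complex_of_real (DR_integral G ?g d ?j as)) / fact (size M) \<le> C (size M) * real R ^ (2 * ?g)"
        by (simp add: divide_le_eq mult.commute)
      have "norm (Ham G d A M e r) = norm (\<Sum>as | mset as = M. complex_of_real (DR_integral G ?g d ?j as)) / fact (size M)"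
        using True by (simp add: Ham_def Let_def norm_mult norm_divide norm_power)
      also note *
      also have "C (size M) * real R ^ (2 * ?g) \<le> ?B * real R ^ (2 * ?g)"
        using M(1) C0 by (intro mult_right_mono member_le_sum) auto
      finally show ?thesis using ge by simp
    next
      case False
      then have "Ham G d A M e r = 0" by (auto simp: Ham_def Let_def)
      with B0 show ?thesis by simp
    qed
    then show "\<exists>C. \<forall>A M. \<forall>R::nat. size M \<le> m \<longrightarrow> (\<forall>a\<in>#M. \<bar>a\<bar> \<le> int R) \<longrightarrow> 1 \<le> R \<longrightarrow>
      norm (Ham G d A M e r) \<le> C * real R ^ (2 * r + e + 0)" by blast
  qed
qed

end

section \<open>Independence of differential monomials\<close>

lemma lists_mset_image:
  assumes "inj f"
  shows "{bs. mset bs = image_mset f M} = map f ` {as. mset as = M}"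
proof
  show "{bs. mset bs = image_mset f M} \<subseteq> map f ` {as. mset as = M}"
  proof
    fix bs assume "bs \<in> {bs. mset bs = image_mset f M}"
    then have bs: "mset bs = image_mset f M" by simp
    have "mset (map (inv f) bs) = M"
      using assms by (simp add: bs multiset.map_comp inv_o_cancel)
    moreover have "set bs \<subseteq> range f"
      using arg_cong[OF bs, of set_mset] by auto
    then have "bs = map f (map (inv f) bs)"
      by (auto simp: map_idI f_inv_into_f subset_iff)
    ultimately show "bs \<in> map f ` {as. mset as = M}" by blast
  qed
qed auto

lemma sum_lists_mset_image:
  assumes "inj f"
  shows "(\<Sum>as | mset as = image_mset f M. h as) = (\<Sum>as | mset as = M. h (map f as))"
  unfolding lists_mset_image[OF assms] 
  by (subst sum.reindex) (use assms in \<open>auto simp: inj_on_def inj_map_eq_map\<close>)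

lemma length_sorted_list_of_multiset: "length (sorted_list_of_multiset U) = size U"
  by (metis mset_sorted_list_of_multiset size_mset)

lemma sum_sorted_list_of_multiset:
  "size U = m \<Longrightarrow> (\<Sum>j<m. sorted_list_of_multiset U ! j) = sum_mset (U :: nat multiset)"
  by (metis length_sorted_list_of_multiset sum_list_sum_nth atLeast0LessThan
      mset_sorted_list_of_multiset sum_mset_sum_list)

text \<open>A differential monomial is homogeneous in the indices, of degree its total number of
  x-derivatives. With a nonzero factor, scaling is a bijection between the orderings of the two
  multisets.\<close>

lemma u_monom_coeff_scale:
  assumes "c \<noteq> 0"
  shows "u_monom_coeff U (image_mset ((*) c) M) = of_int c ^ sum_mset U * u_monom_coeff U M"
proof (cases "size U = size M")
  case True
  let ?s = "sorted_list_of_multiset U" and ?m = "size M"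
  have inj: "inj ((*) c)" using assms by (auto simp: inj_on_def)
  have "(\<Prod>j<?m. (\<i> * of_int (map ((*) c) as ! j)) ^ (?s ! j)) =
      of_int c ^ sum_mset U * (\<Prod>j<?m. (\<i> * of_int (as ! j)) ^ (?s ! j))" if "mset as = M" for as
  proof -
    have len: "length as = ?m" using that by auto
    have "(\<Prod>j<?m. (\<i> * of_int (map ((*) c) as ! j)) ^ (?s ! j)) =
        (\<Prod>j<?m. of_int c ^ (?s ! j) * (\<i> * of_int (as ! j)) ^ (?s ! j))"
      by (intro prod.cong) (auto simp: len mult.left_commute simp flip: power_mult_distrib)
    also have "\<dots> = of_int c ^ (\<Sum>j<?m. ?s ! j) * (\<Prod>j<?m. (\<i> * of_int (as ! j)) ^ (?s ! j))"
      by (simp add: prod.distrib power_sum)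
    finally show ?thesis by (simp add: sum_sorted_list_of_multiset True)
  qed
  then show ?thesis
    by (simp add: u_monom_coeff_def True sum_lists_mset_image[OF inj] sum_distrib_left)
qed (simp add: u_monom_coeff_def)

lemma u_monom_coeff_reflect: "u_monom_coeff U (reflect M) = (-1) ^ sum_mset U * u_monom_coeff U M"
proof -
  have "(*) (- 1 :: int) = uminus" by (simp add: fun_eq_iff)
  with u_monom_coeff_scale[of "-1" U M] show ?thesis by simp
qed

lemma norm_u_monom_coeff_le:
  assumes "\<forall>a\<in>#M. \<bar>a\<bar> \<le> int R"
  shows "norm (u_monom_coeff U M) \<le> fact (size M) * real R ^ sum_mset U"
proof (cases "size U = size M")
  case True
  let ?s = "sorted_list_of_multiset U" and ?m = "size M"
  have "norm (\<Prod>j<?m. (\<i> * of_int (as ! j)) ^ (?s ! j)) \<le> real R ^ sum_mset U" if as: "mset as = M" for as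
  proof -
    have "norm (\<Prod>j<?m. (\<i> * complex_of_int (as ! j)) ^ (?s ! j)) = (\<Prod>j<?m. \<bar>real_of_int (as ! j)\<bar> ^ (?s ! j))"
      by (simp add: norm_mult norm_power flip: prod_norm)
    also have "\<dots> \<le> (\<Prod>j<?m. real R ^ (?s ! j))"
    proof (intro prod_mono conjI power_mono)
      fix j assume "j \<in> {..<?m}"
      then have "as ! j \<in># M" using as by (metis lessThan_iff nth_mem set_mset_mset size_mset)
      then have "\<bar>as ! j\<bar> \<le> int R" using assms by blast
      then show "\<bar>real_of_int (as ! j)\<bar> \<le> real R" by linarith
    qed auto
    also have "\<dots> = real R ^ (\<Sum>j<?m. ?s ! j)" by (simp add: power_sum)
    finally show ?thesis by (simp add: sum_sorted_list_of_multiset True)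
  qed
  then have "norm (u_monom_coeff U M) \<le> (\<Sum>as | mset as = M. real R ^ sum_mset U)"
    unfolding u_monom_coeff_def if_P[OF True] by (intro sum_norm_le) auto
  also have "\<dots> = real (card {as. mset as = M}) * real R ^ sum_mset U" by simp
  also have "\<dots> \<le> fact (size M) * real R ^ sum_mset U"
    using of_nat_mono[OF card_lists_mset(2)[of M], where 'a = real] by (intro mult_right_mono) simp_all
  finally show ?thesis .
qed (simp add: u_monom_coeff_def)

section \<open>Kronecker substitution and linear independence\<close>

lemma digits_unique:
  fixes f g :: "nat \<Rightarrow> nat"
  assumes "(\<Sum>i<m. B ^ i * f i) = (\<Sum>i<m. B ^ i * g i)" "\<And>i. i < m \<Longrightarrow> f i < B" "\<And>i. i < m \<Longrightarrow> g i < B" "i < m"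
  shows "f i = g i"
  using assms
proof (induction m arbitrary: f g i)
  case (Suc m)
  have expand: "(\<Sum>i<Suc m. B ^ i * h i) = h 0 + B * (\<Sum>i<m. B ^ i * h (Suc i))" for h :: "nat \<Rightarrow> nat"
    unfolding sum.lessThan_Suc_shift by (simp add: sum_distrib_left mult.assoc)
  have eq: "f 0 + B * (\<Sum>i<m. B ^ i * f (Suc i)) = g 0 + B * (\<Sum>i<m. B ^ i * g (Suc i))"
    using Suc.prems(1) unfolding expand .
  have lt: "f 0 < B" "g 0 < B" using Suc.prems(2,3) by auto
  have 0: "f 0 = g 0"
    using arg_cong[OF eq, of "\<lambda>x. x mod B"] lt by simp
  moreover have "B > 0" using lt by simp
  ultimately have "(\<Sum>i<m. B ^ i * f (Suc i)) = (\<Sum>i<m. B ^ i * g (Suc i))"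
    using eq by simp
  from Suc.IH[OF this] Suc.prems(2-4) 0 show ?case
    by (cases i) auto
qed simp

text \<open>Both sums are base B expansions, with the entries of V and a permutation of those of U
  as digits; B exceeds all entries, so the digits agree.\<close>

lemma kronecker_exponent_unique:
  fixes U V :: "nat multiset"
  assumes "size U = m" "size V = m" "sum_mset U < B" "sum_mset V < B"
    and bs: "mset bs = mset (map (\<lambda>j. B ^ j) [0..<m])"
    and eq: "(\<Sum>j<m. bs ! j * sorted_list_of_multiset U ! j) = (\<Sum>j<m. B ^ j * sorted_list_of_multiset V ! j)"
  shows "U = V"
proof -
  let ?u = "sorted_list_of_multiset U" and ?v = "sorted_list_of_multiset V"
  have len: "length ?u = m" "length ?v = m" using assms by (simp_all add: length_sorted_list_of_multiset)
  have less: "?u ! i < B" "?v ! i < B" if "i < m" for i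
  proof -
    have "?u ! i \<in># U" "?v ! i \<in># V" using that len by (metis nth_mem set_sorted_list_of_multiset)+
    then have "?u ! i \<le> sum_mset U" "?v ! i \<le> sum_mset V"
      by (metis le_add1 multi_member_split sum_mset.add_mset)+
    then show "?u ! i < B" "?v ! i < B" using assms by simp_all
  qed
  obtain p where p: "p permutes {..<m}" "permute_list p (map (\<lambda>j. B ^ j) [0..<m]) = bs"
    using mset_eq_permutation[OF bs] by auto
  have ip: "inv p permutes {..<m}" using p(1) by (rule permutes_inv)
  have bs_nth: "bs ! j = B ^ p j" if "j < m" for j
  proof -
    have "p j < m" using permutes_in_image[OF p(1), of j] that by simp
    with that show ?thesis
      unfolding p(2)[symmetric] by (subst permute_list_nth) (use p(1) in auto)
  qed
  have "(\<Sum>j<m. B ^ j * ?v ! j) = (\<Sum>j<m. B ^ p j * ?u ! j)"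
    unfolding eq[symmetric] by (intro sum.cong) (simp_all add: bs_nth)
  also have "\<dots> = (\<Sum>j<m. B ^ j * ?u ! inv p j)"
    by (subst sum.permute[OF ip]) (simp add: permutes_inverses(1)[OF p(1)] comp_def)
  finally have "(\<Sum>j<m. B ^ j * ?v ! j) = (\<Sum>j<m. B ^ j * ?u ! inv p j)" .
  then have "?v ! i = ?u ! inv p i" if "i < m" for i
  proof (rule digits_unique[OF _ _ _ that])
    fix i assume "i < m"
    then have "inv p i < m" using permutes_in_image[OF ip, of i] by simp
    then show "?u ! inv p i < B" by (rule less)
  qed (rule less)
  then have "?v = permute_list (inv p) ?u"
    using ip by (intro nth_equalityI) (simp_all add: len permute_list_nth)
  then have "mset ?v = mset ?u" using ip len by (simp add: mset_permute_list)
  then show ?thesis by simp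
qed

text \<open>Kronecker substitution \<open>a_j = x^(B^j)\<close> turns distinct monomials into distinct powers of \<open>x\<close>.\<close>

lemma u_monom_coeff_independent:
  assumes fin: "finite S" and size: "\<And>U. U \<in> S \<Longrightarrow> size U = m" and U0: "U0 \<in> S"
    and zero: "\<And>M. size M = m \<Longrightarrow> (m > 0 \<Longrightarrow> sum_mset M > 0) \<Longrightarrow> (\<Sum>U\<in>S. c U * u_monom_coeff U M) = 0"
  shows "c U0 = 0"
proof -
  define B where "B = (\<Sum>U\<in>S. sum_mset U) + 2"
  have B: "sum_mset U < B" if "U \<in> S" for U
    using member_le_sum[OF that, of sum_mset] fin by (simp add: B_def)
  define bs0 where "bs0 = map (\<lambda>j. B ^ j) [0..<m]"
  define L where "L = {bs. mset bs = mset bs0}"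
  define E where "E U bs = (\<Sum>j<m. bs ! j * sorted_list_of_multiset U ! j)" for U and bs :: "nat list"
  define p where "p = (\<Sum>U\<in>S. \<Sum>bs\<in>L. monom (c U * \<i> ^ sum_mset U) (E U bs))"
  have finL: "finite L" unfolding L_def by (rule card_lists_mset(1))
  have sz: "length bs0 = m" by (simp add: bs0_def)
  \<comment> \<open>For x \<ge> 2 the map taking b to the b-th power of x is injective, so orderings
    of the exponents and of M correspond; its values are positive, so M is an admissible test
    point.\<close>
  have "poly p (of_nat x) = 0" if x: "x \<ge> 2" for x :: nat
  proof -
    define M where "M = image_mset (\<lambda>b. int x ^ b) (mset bs0)"
    have sM: "size M = m" by (simp add: M_def sz)
    have inj: "inj (\<lambda>b. int x ^ b)" using x by (auto simp: inj_on_def)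
    have "sum_mset M > 0" if "m > 0"
    proof -
      have "\<forall>a\<in>#M. 0 < a" using x by (auto simp: M_def)
      moreover from sM that obtain b where "b \<in># M" by (cases M) auto
      ultimately show ?thesis using member_le_sum_mset[of M b] by fastforce
    qed
    from zero[OF sM this] have "(\<Sum>U\<in>S. c U * u_monom_coeff U M) = 0" .
    moreover have "u_monom_coeff U M = (\<Sum>bs\<in>L. \<i> ^ sum_mset U * of_nat x ^ E U bs)" if U: "U \<in> S" for U
    proof -
      let ?s = "sorted_list_of_multiset U"
      have "(\<Prod>j<m. (\<i> * of_int (map (\<lambda>b. int x ^ b) bs ! j)) ^ (?s ! j)) = \<i> ^ sum_mset U * of_nat x ^ E U bs" if "bs \<in> L" for bs
      proof -
        have len: "length bs = m" using that sz mset_eq_length[of bs bs0] by (simp add: L_def)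
        have "(\<Prod>j<m. (\<i> * complex_of_int (map (\<lambda>b. int x ^ b) bs ! j)) ^ (?s ! j)) =
            (\<Prod>j<m. \<i> ^ (?s ! j) * of_nat x ^ (bs ! j * ?s ! j))"
          by (intro prod.cong) (auto simp: len power_mult_distrib power_mult)
        also have "\<dots> = \<i> ^ (\<Sum>j<m. ?s ! j) * of_nat x ^ E U bs"
          by (simp add: prod.distrib power_sum E_def)
        finally show ?thesis by (simp add: sum_sorted_list_of_multiset size[OF U])
      qed
      then show ?thesis
        unfolding u_monom_coeff_def sM size[OF U] unfolding M_def sum_lists_mset_image[OF inj]
        by (simp add: L_def)
    qed
    ultimately show ?thesis
      by (simp add: p_def poly_sum poly_monom sum_distrib_left mult.assoc)
  qed
  then have "of_nat ` {2..} \<subseteq> {x. poly p x = 0}" by auto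
  moreover have "infinite (of_nat ` {2..} :: complex set)"
    by (subst finite_image_iff) (auto simp: inj_on_def infinite_Ici)
  ultimately have p0: "p = 0" using poly_roots_finite[of p] finite_subset by blast
  let ?E0 = "E U0 bs0" and ?L0 = "{bs \<in> L. E U0 bs = E U0 bs0}"
  have other: "E U bs \<noteq> ?E0" if "U \<in> S" "U \<noteq> U0" "bs \<in> L" for U bs
  proof
    assume "E U bs = ?E0"
    moreover have "?E0 = (\<Sum>j<m. B ^ j * sorted_list_of_multiset U0 ! j)"
      unfolding E_def by (intro sum.cong) (auto simp: bs0_def)
    ultimately have "U = U0"
      using that size U0 B by (intro kronecker_exponent_unique[of U m U0 B bs]) (auto simp: L_def bs0_def E_def)
    with that show False by simp
  qed
  \<comment> \<open>Several orderings can give the exponent \<open>?E0\<close> when U0 has repeated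
    entries, but they all carry the same coefficient, so nothing cancels.\<close>
  have "0 = coeff p ?E0" by (simp add: p0)
  also have "\<dots> = (\<Sum>U\<in>S. \<Sum>bs\<in>L. if E U bs = ?E0 then c U * \<i> ^ sum_mset U else 0)"
    by (simp add: p_def coeff_sum)
  also have "\<dots> = (\<Sum>U\<in>{U0}. \<Sum>bs\<in>L. if E U bs = ?E0 then c U * \<i> ^ sum_mset U else 0)"
    using other U0 by (intro sum.mono_neutral_right fin ballI sum.neutral) auto
  also have "\<dots> = of_nat (card ?L0) * (c U0 * \<i> ^ sum_mset U0)"
    using finL by (simp add: sum.If_cases Int_def)
  finally have "of_nat (card ?L0) * (c U0 * \<i> ^ sum_mset U0) = 0" by simp
  moreover have "bs0 \<in> ?L0" by (simp add: L_def)
  then have "card ?L0 \<noteq> 0" using finL by (auto simp: card_eq_0_iff)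
  ultimately show ?thesis by simp
qed

text \<open>Splitting off the constant coefficient, p = a + x q, lowers the exponent by one and
  reduces to D = 0, where a nonconstant polynomial would be unbounded on the positive
  integers.\<close>

lemma degree_le_of_growth:
  fixes p :: "complex poly"
  assumes "\<And>t::nat. t \<ge> 1 \<Longrightarrow> norm (poly p (of_nat t)) \<le> C * real t ^ D"
  shows "degree p \<le> D"
  using assms
proof (induction D arbitrary: p C)
  case 0
  obtain a q where p: "p = pCons a q" by (cases p)
  have "q = 0"
  proof (rule ccontr)
    assume "q \<noteq> 0"
    from poly_infinity[OF this, of "C + 1" a] obtain r where r: "\<And>z. r \<le> norm z \<Longrightarrow> C + 1 \<le> norm (poly p z)"
      unfolding p by blast
    define t where "t = nat \<lceil>max r 1\<rceil>"
    have "max r 1 \<le> real t" unfolding t_def by (metis of_nat_ceiling)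
    then have "r \<le> norm (of_nat t :: complex)" "t \<ge> 1" by simp_all
    with r[of "of_nat t"] 0[of t] show False by simp
  qed
  then show ?case by (simp add: p)
next
  case (Suc D)
  obtain a q where p: "p = pCons a q" by (cases p)
  have "norm (poly q (of_nat t)) \<le> (C + norm a) * real t ^ D" if t: "t \<ge> 1" for t :: nat
  proof -
    have "of_nat t * poly q (of_nat t) = poly p (of_nat t) - a" by (simp add: p)
    then have "real t * norm (poly q (of_nat t)) = norm (poly p (of_nat t) - a)"
      by (metis norm_mult norm_of_nat)
    also have "\<dots> \<le> C * real t ^ Suc D + norm a"
      using norm_triangle_ineq4[of "poly p (of_nat t)" a] Suc.prems[OF t] by linarith
    also have "norm a \<le> norm a * real t ^ Suc D"
      using t mult_left_mono[of 1 "real t ^ Suc D" "norm a"] one_le_power[of "real t" "Suc D"] by simp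
    finally have "real t * norm (poly q (of_nat t)) \<le> real t * ((C + norm a) * real t ^ D)"
      by (simp add: algebra_simps)
    then show ?thesis using t by simp
  qed
  from Suc.IH[OF this] show ?case by (simp add: p)
qed

section \<open>Graded differential polynomials\<close>

definition graded_at :: "int \<Rightarrow> nat \<Rightarrow> complex \<Rightarrow> nat multiset \<Rightarrow> nat \<Rightarrow> nat \<Rightarrow> bool" where
  "graded_at w c s U e r \<longleftrightarrow>
     int (4 * r + e + 2 * size U) = w \<and> (- 1) ^ sum_mset U = s \<and> sum_mset U \<le> 2 * r + e + c"

lemma diff_polys_finite: "f \<in> diff_polys \<Longrightarrow> finite {U. f U e r \<noteq> 0}"
  by (simp add: diff_polys_def)

lemma to_fourier_homogeneous:
  assumes "f \<in> diff_polys" "size M = m"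
  shows "to_fourier f (sum_mset M) M e r = (\<Sum>U | f U e r \<noteq> 0 \<and> size U = m. f U e r * u_monom_coeff U M)"
  unfolding to_fourier_def if_P[OF refl]
  using diff_polys_finite[OF assms(1)] assms(2)
  by (intro sum.mono_neutral_right) (auto simp: u_monom_coeff_def)

lemma graded_to_fourier:
  assumes f: "f \<in> diff_polys" and gr: "\<And>U e r. f U e r \<noteq> 0 \<Longrightarrow> graded_at w c s U e r"
  shows "graded w c s (to_fourier f)"
  unfolding graded_def
proof (intro conjI allI impI)
  fix A M and e r :: nat assume nz: "to_fourier f A M e r \<noteq> 0"
  then have A: "sum_mset M = A" and "(\<Sum>U | f U e r \<noteq> 0. f U e r * u_monom_coeff U M) \<noteq> 0"
    by (auto simp: to_fourier_def split: if_splits)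
  from this(2) obtain U where "U \<in> {U. f U e r \<noteq> 0}" and nz: "f U e r * u_monom_coeff U M \<noteq> 0"
    by (rule sum.not_neutral_contains_not_neutral)
  then have "f U e r \<noteq> 0" "size U = size M" by (auto simp: u_monom_coeff_def split: if_splits)
  with gr[OF this(1)] A show "sum_mset M = A" "int (4 * r + e + 2 * size M) = w"
    by (simp_all add: graded_at_def)
next
  fix A M and e r :: nat
  have "f U e r * u_monom_coeff U (reflect M) = s * (f U e r * u_monom_coeff U M)" if "f U e r \<noteq> 0" for U
    using gr[OF that] by (simp add: graded_at_def u_monom_coeff_reflect)
  then show "to_fourier f (- A) (reflect M) e r = s * to_fourier f A M e r"
    by (simp add: to_fourier_def sum_mset_reflect sum_distrib_left mult.left_commute)
next
  fix e r :: nat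
  have "growth (2 * r + e + c) (\<lambda>A M. f U e r * (if sum_mset M = A then u_monom_coeff U M else 0))"
    if nz: "f U e r \<noteq> 0" for U
  proof (rule growth_cmult, rule growth_mono)
    show "sum_mset U \<le> 2 * r + e + c" using gr[OF nz] by (simp add: graded_at_def)
    show "growth (sum_mset U) (\<lambda>A M. if sum_mset M = A then u_monom_coeff U M else 0)"
    proof (rule growthI)
      fix m
      have "norm (if sum_mset M = A then u_monom_coeff U M else 0) \<le> fact m * real R ^ sum_mset U"
        if M: "size M \<le> m" "\<forall>a\<in>#M. \<bar>a\<bar> \<le> int R" for A M R
      proof -
        have "norm (u_monom_coeff U M) \<le> fact (size M) * real R ^ sum_mset U"
          by (rule norm_u_monom_coeff_le[OF M(2)])
        also have "\<dots> \<le> fact m * real R ^ sum_mset U"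
          using M(1) by (intro mult_right_mono fact_mono) auto
        finally show ?thesis by simp
      qed
      then show "\<exists>C. \<forall>A M. \<forall>R::nat. size M \<le> m \<longrightarrow> (\<forall>a\<in>#M. \<bar>a\<bar> \<le> int R) \<longrightarrow> 1 \<le> R \<longrightarrow>
        norm (if sum_mset M = A then u_monom_coeff U M else 0) \<le> C * real R ^ sum_mset U" by blast
    qed
  qed
  then have "growth (2 * r + e + c) (\<lambda>A M. \<Sum>U | f U e r \<noteq> 0. f U e r * (if sum_mset M = A then u_monom_coeff U M else 0))"
    by (intro growth_sum) auto
  moreover have "(\<lambda>A M. \<Sum>U | f U e r \<noteq> 0. f U e r * (if sum_mset M = A then u_monom_coeff U M else 0))
      = (\<lambda>A M. to_fourier f A M e r)"
    by (auto simp: fun_eq_iff to_fourier_def)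
  ultimately show "growth (2 * r + e + c) (\<lambda>A M. to_fourier f A M e r)" by simp
qed

lemma graded_deriv_x:
  assumes "graded w c s \<phi>"
  shows "graded w (c + 1) (- s) (deriv_x \<phi>)"
  unfolding graded_def
proof (intro conjI allI impI)
  fix A M and e r :: nat assume "deriv_x \<phi> A M e r \<noteq> 0"
  then have "\<phi> A M e r \<noteq> 0" by (auto simp: deriv_x_def)
  then show "sum_mset M = A" "int (4 * r + e + 2 * size M) = w" by (rule gradedD[OF assms])+
next
  fix A M and e r :: nat
  show "deriv_x \<phi> (- A) (reflect M) e r = - s * deriv_x \<phi> A M e r"
    by (simp add: deriv_x_def gradedD(3)[OF assms])
next
  fix e r :: nat
  show "growth (2 * r + e + (c + 1)) (\<lambda>A M. deriv_x \<phi> A M e r)"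
  proof (rule growthI)
    fix m
    obtain C where C: "C \<ge> 0" "\<And>A M R. size M \<le> m \<Longrightarrow> \<forall>a\<in>#M. \<bar>a\<bar> \<le> int R \<Longrightarrow> 1 \<le> R \<Longrightarrow>
        norm (\<phi> A M e r) \<le> C * real R ^ (2 * r + e + c)"
      by (rule growthE[OF gradedD(4)[OF assms], of m]) (rule that)
    have "norm (deriv_x \<phi> A M e r) \<le> (real m * C) * real R ^ (2 * r + e + (c + 1))"
      if M: "size M \<le> m" "\<forall>a\<in>#M. \<bar>a\<bar> \<le> int R" "1 \<le> R" for A M R
    proof (cases "\<phi> A M e r = 0")
      case True
      then show ?thesis using C(1) by (simp add: deriv_x_def)
    next
      case False
      then have "A = sum_mset M" using gradedD(1)[OF assms] by blast
      then have "\<bar>A\<bar> \<le> int (size M) * int R" using abs_sum_mset_le[OF M(2)] by simp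
      also have "\<dots> \<le> int m * int R" using M(1) by (intro mult_right_mono) auto
      finally have "\<bar>A\<bar> \<le> int (m * R)" by simp
      then have "\<bar>real_of_int A\<bar> \<le> real m * real R" by (metis of_int_abs of_int_le_iff of_int_of_nat_eq of_nat_mult)
      then have "\<bar>real_of_int A\<bar> * norm (\<phi> A M e r) \<le> (real m * real R) * (C * real R ^ (2 * r + e + c))"
        using C(2)[OF M] by (intro mult_mono) auto
      then show ?thesis by (simp add: deriv_x_def norm_mult algebra_simps)
    qed
    then show "\<exists>C. \<forall>A M. \<forall>R::nat. size M \<le> m \<longrightarrow> (\<forall>a\<in>#M. \<bar>a\<bar> \<le> int R) \<longrightarrow> 1 \<le> R \<longrightarrow>
        norm (deriv_x \<phi> A M e r) \<le> C * real R ^ (2 * r + e + (c + 1))" by blast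
  qed
qed

text \<open>Division by \<open>\<partial>_x\<close> lowers the differential degree by one.  The growth of Fourier coefficients does
  not show this at the modes close to \<open>0\<close>, hence the detour through the polynomials.\<close>

lemma graded_at_of_deriv_x:
  assumes f: "f \<in> diff_polys" and gr: "graded w (c + 1) (- s) (deriv_x (to_fourier f))"
    and nz: "f U e r \<noteq> 0" and U: "U \<noteq> {#}"
  shows "graded_at w c s U e r"
proof -
  define m where "m = size U"
  define S where "S = {U. f U e r \<noteq> 0 \<and> size U = m}"
  have m: "m > 0" using U by (simp add: m_def nonempty_has_size)
  have fin: "finite S" unfolding S_def by (rule finite_subset[OF _ diff_polys_finite[OF f, of e r]]) auto
  have US: "U \<in> S" using nz by (simp add: S_def m_def)
  have size: "\<And>V. V \<in> S \<Longrightarrow> size V = m" by (simp add: S_def)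
  have deriv: "deriv_x (to_fourier f) (sum_mset M) M e r =
      \<i> * of_int (sum_mset M) * (\<Sum>V\<in>S. f V e r * u_monom_coeff V M)" if "size M = m" for M
    unfolding deriv_x_def to_fourier_homogeneous[OF f that] S_def by simp
  have "int (4 * r + e + 2 * m) = w"
  proof (rule ccontr)
    assume ne: "int (4 * r + e + 2 * m) \<noteq> w"
    have "f U e r = 0"
    proof (rule u_monom_coeff_independent[OF fin size US, where c = "\<lambda>U. f U e r"])
      fix M assume M: "size M = m" "m > 0 \<Longrightarrow> sum_mset (M :: int multiset) > 0"
      have "deriv_x (to_fourier f) (sum_mset M) M e r = 0"
        using gradedD(2)[OF gr, of "sum_mset M" M e r] M(1) ne by blast
      then show "(\<Sum>V\<in>S. f V e r * u_monom_coeff V M) = 0"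
        unfolding deriv[OF M(1)] using M(2)[OF m] by simp
    qed
    with nz show False by simp
  qed
  moreover have "(- 1) ^ sum_mset U = s"
  proof -
    \<comment> \<open>Independence is applied to the difference of the two sides of the reflection
      identity; the mode cancels because the test points have positive sum.\<close>
    have "f U e r * ((- 1) ^ sum_mset U - s) = 0"
    proof (rule u_monom_coeff_independent[OF fin size US, where c = "\<lambda>U. f U e r * ((- 1) ^ sum_mset U - s)"])
      fix M assume M: "size M = m" "m > 0 \<Longrightarrow> sum_mset (M :: int multiset) > 0"
      have "deriv_x (to_fourier f) (sum_mset (reflect M)) (reflect M) e r = - s * deriv_x (to_fourier f) (sum_mset M) M e r"
        using gradedD(3)[OF gr] by (simp add: sum_mset_reflect)
      moreover have sR: "size (reflect M) = m" using M(1) by simp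
      ultimately have "\<i> * of_int (sum_mset M) * ((\<Sum>V\<in>S. f V e r * u_monom_coeff V (reflect M)) - s * (\<Sum>V\<in>S. f V e r * u_monom_coeff V M)) = 0"
        unfolding deriv[OF M(1)] sum_mset_reflect deriv[OF sR, unfolded sum_mset_reflect] by (simp add: algebra_simps)
      then have "(\<Sum>V\<in>S. f V e r * u_monom_coeff V (reflect M)) - s * (\<Sum>V\<in>S. f V e r * u_monom_coeff V M) = 0"
        using M(2)[OF m] by simp
      then show "(\<Sum>V\<in>S. f V e r * ((- 1) ^ sum_mset V - s) * u_monom_coeff V M) = 0"
        by (simp add: u_monom_coeff_reflect sum_distrib_left algebra_simps sum_subtractf)
    qed
    with nz show ?thesis by simp
  qed
  moreover have "sum_mset U \<le> 2 * r + e + c"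
  proof (rule ccontr)
    assume big: "\<not> sum_mset U \<le> 2 * r + e + c"
    \<comment> \<open>Only the monomials with the differential degree of U are kept: their sum at M
      is one coefficient of the polynomial \<open>p\<close> below, and independence applies to that
      part alone.\<close>
    let ?c = "\<lambda>V. if sum_mset V = sum_mset U then f V e r else 0"
    have "?c U = 0"
    proof (rule u_monom_coeff_independent[OF fin size US, where c = ?c])
      fix M assume M: "size M = m" "m > 0 \<Longrightarrow> sum_mset (M :: int multiset) > 0"
      obtain C where C: "C \<ge> 0" "\<And>A M R. size M \<le> m \<Longrightarrow> \<forall>a\<in>#M. \<bar>a\<bar> \<le> int R \<Longrightarrow> 1 \<le> R \<Longrightarrow>
          norm (deriv_x (to_fourier f) A M e r) \<le> C * real R ^ (2 * r + e + (c + 1))"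
        by (rule growthE[OF gradedD(4)[OF gr], of m]) (rule that)
      define R where "R = Suc (\<Sum>a\<in>#M. nat \<bar>a\<bar>)"
      have R: "\<bar>a\<bar> \<le> int R" if "a \<in># M" for a
      proof -
        from that obtain M' where "M = add_mset a M'" by (auto dest: multi_member_split)
        then have "nat \<bar>a\<bar> \<le> R" by (simp add: R_def)
        then show ?thesis by linarith
      qed
      \<comment> \<open>The m-letter part along the ray t M. Scaling by t also multiplies the mode
        by t, so the x-derivative supplies a factor t that cancels the extra unit of growth.\<close>
      define p where "p = (\<Sum>V\<in>S. monom (f V e r * u_monom_coeff V M) (sum_mset V))"
      define A where "A = sum_mset M"
      have A: "A > 0" using M(2)[OF m] by (simp add: A_def)
      have "norm (poly p (of_nat t)) \<le> (C * real R ^ (2 * r + e + (c + 1)) / real_of_int A) * real t ^ (2 * r + e + c)"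
        if t: "t \<ge> 1" for t :: nat
      proof -
        let ?N = "image_mset ((*) (int t)) M"
        have "sum_mset (image_mset ((*) c) M) = c * sum_mset M" for c :: int
          by (induction M) (auto simp: distrib_left)
        then have N: "size ?N = m" "sum_mset ?N = int t * A" using M(1) by (simp_all add: A_def)
        have "\<bar>int t * a\<bar> \<le> int (t * R)" if "a \<in># M" for a
          using R[OF that] by (simp add: abs_mult mult_left_mono)
        then have N_le: "\<forall>a\<in>#?N. \<bar>a\<bar> \<le> int (t * R)" by simp
        have "1 \<le> t * R" using t by (simp add: R_def)
        have "u_monom_coeff V ?N = of_nat t ^ sum_mset V * u_monom_coeff V M" for V
          using u_monom_coeff_scale[of "int t" V M] t by simp
        then have "poly p (of_nat t) = (\<Sum>V\<in>S. f V e r * u_monom_coeff V ?N)"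
          by (simp add: p_def poly_sum poly_monom mult_ac)
        then have eq: "norm (deriv_x (to_fourier f) (sum_mset ?N) ?N e r) = real t * real_of_int A * norm (poly p (of_nat t))"
          unfolding N(2) deriv[OF N(1), unfolded N(2)] using A by (simp add: norm_mult)
        have "norm (deriv_x (to_fourier f) (sum_mset ?N) ?N e r) \<le> C * real (t * R) ^ (2 * r + e + (c + 1))"
          using N(1) by (intro C(2)[OF _ N_le \<open>1 \<le> t * R\<close>]) simp
        also have "\<dots> = real t * (C * real R ^ (2 * r + e + (c + 1)) * real t ^ (2 * r + e + c))"
          by (simp add: power_mult_distrib)
        finally have "real_of_int A * norm (poly p (of_nat t)) \<le> C * real R ^ (2 * r + e + (c + 1)) * real t ^ (2 * r + e + c)"
          using t unfolding eq mult.assoc[of "real t"] by simp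
        then show ?thesis using A by (simp add: field_simps)
      qed
      then have "degree p \<le> 2 * r + e + c" by (rule degree_le_of_growth)
      with big have "coeff p (sum_mset U) = 0" by (intro coeff_eq_0) simp
      then show "(\<Sum>V\<in>S. ?c V * u_monom_coeff V M) = 0"
        by (simp add: p_def coeff_sum if_distrib[of "\<lambda>x. x * _"] cong: if_cong)
    qed
    with nz show False by simp
  qed
  ultimately show ?thesis by (simp add: graded_at_def m_def)
qed

lemma to_fourier_empty: 
  assumes "f \<in> diff_polys"
  shows "to_fourier f 0 {#} e r = f {#} e r"
proof -
  have "to_fourier f (sum_mset {#}) {#} e r = (\<Sum>U | f U e r \<noteq> 0 \<and> size U = 0. f U e r * u_monom_coeff U {#})"
    by (rule to_fourier_homogeneous[OF assms]) simp
  also have "{U. f U e r \<noteq> 0 \<and> size U = 0} = (if f {#} e r \<noteq> 0 then {{#}} else {})" by auto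
  finally show ?thesis by (simp add: u_monom_coeff_def)
qed

text \<open>Differentiation reduces this to \<open>graded_at_of_deriv_x\<close>, except for the
  empty monomial, which it kills; the reflection fixes \<open>{#}\<close>, so a nonzero constant
  forces s = 1.\<close>

lemma graded_at_of_to_fourier:
  assumes f: "f \<in> diff_polys" and gr: "graded w c s (to_fourier f)" and nz: "f U e r \<noteq> 0"
  shows "graded_at w c s U e r"
proof (cases "U = {#}")
  case True
  have nz': "to_fourier f 0 {#} e r \<noteq> 0" using nz True to_fourier_empty[OF f] by simp
  have "int (4 * r + e + 2 * size U) = w" using gradedD(2)[OF gr nz'] True by simp
  moreover have "s = 1" using gradedD(3)[OF gr, of 0 "{#}" e r] nz' by simp
  ultimately show ?thesis using True by (simp add: graded_at_def)
next
  case False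
  show ?thesis using graded_at_of_deriv_x[OF f graded_deriv_x[OF gr] nz False] .
qed

lemma graded_scaled_sum:
  assumes "\<And>i. i \<in> I \<Longrightarrow> graded w c s (\<phi> i)"
  shows "graded w c s (\<lambda>A M e r. a * (\<Sum>i\<in>I. \<phi> i A M e r))"
  unfolding graded_def
proof (intro conjI allI impI)
  fix A M and e r :: nat assume "a * (\<Sum>i\<in>I. \<phi> i A M e r) \<noteq> 0"
  then have "(\<Sum>i\<in>I. \<phi> i A M e r) \<noteq> 0" by simp
  then obtain i where "i \<in> I" "\<phi> i A M e r \<noteq> 0"
    by (rule sum.not_neutral_contains_not_neutral)
  then show "sum_mset M = A" "int (4 * r + e + 2 * size M) = w" using gradedD(1,2)[OF assms] by blast+
next
  fix A M and e r :: nat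
  show "a * (\<Sum>i\<in>I. \<phi> i (- A) (reflect M) e r) = s * (a * (\<Sum>i\<in>I. \<phi> i A M e r))"
    using gradedD(3)[OF assms] by (simp add: sum_distrib_left mult.left_commute)
next
  fix e r :: nat
  show "growth (2 * r + e + c) (\<lambda>A M. a * (\<Sum>i\<in>I. \<phi> i A M e r))"
    using gradedD(4)[OF assms] by (intro growth_cmult growth_sum)
qed

section \<open>Two-point functions and correlators\<close>

context dr_geometry
begin

text \<open>The commutator of two Hamiltonians has c = 1 and sign -1, and undoing the x-derivative
  yields c = 0 and sign 1. Additive constants satisfy the latter automatically; only their weight is
  in question.\<close>

lemma graded_two_point_functions:
  assumes tp: "two_point_functions G \<Omega>"
  shows "graded (2 * (int d1 + int d2 + 1)) 0 1 (\<Omega> d1 d2)"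
proof -
  define W where "W d1 d2 = 2 * (int d1 + int d2 + 1)" for d1 d2 :: nat
  have "\<exists>f. f \<in> diff_polys \<and> \<Omega> d1 d2 = to_fourier f" for d1 d2
    using tp unfolding two_point_functions_def fourier_diff_polys_def by blast
  then obtain \<omega> where \<omega>: "\<And>d1 d2. \<omega> d1 d2 \<in> diff_polys" "\<And>d1 d2. \<Omega> d1 d2 = to_fourier (\<omega> d1 d2)"
    by metis
  have gr: "graded (W d1 d2) (0 + 1) (- 1) (deriv_x (to_fourier (\<omega> d1 d2)))" for d1 d2
  proof -
    have "deriv_x (\<Omega> d1 d2) = fourier_div_hbar (fourier_commutator (Ham G (int d1 - 1)) (Ham_bar G (int d2)))"
      using tp unfolding two_point_functions_def by blast
    with graded_commutator[OF graded_Ham graded_Ham, of "int d1 - 1" "int d2"] show ?thesis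
      by (simp add: \<omega>(2) W_def Ham_bar_def algebra_simps)
  qed
  have pos: "graded_at (W d1 d2) 0 1 U e r" if "\<omega> d1 d2 U e r \<noteq> 0" "U \<noteq> {#}" for d1 d2 U e r
    using graded_at_of_deriv_x[OF \<omega>(1) gr that] .
  have Ham0: "int (4 * r + e) = W 0 d" if "Ham G (int d - 1) 0 {#} e r \<noteq> 0" for d e r
    using gradedD(2)[OF graded_Ham that] by (simp add: W_def)
  \<comment> \<open>The normalization, solved for the constant of
    \<open>\<Omega> (Suc d1) d2\<close>, involves the constant of
    \<open>\<Omega> d1 (Suc d2)\<close> and the linear coefficient in \<open>p_0\<close> of
    \<open>\<Omega> (Suc d1) (Suc d2)\<close>. The latter stems from nonconstant monomials, whose
    weight is known; their one letter accounts for 2. As d2 grows, it is kept arbitrary.\<close>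
  have const: "int (4 * r + e) = W d1 d2" if "\<Omega> d1 d2 0 {#} e r \<noteq> 0" for d1 d2 e r
    using that
  proof (induction d1 arbitrary: d2)
    case 0
    have "at_p_zero (\<Omega> 0 d2) = at_p_zero (Ham G (int d2 - 1))"
      using tp unfolding two_point_functions_def by blast
    then have "\<Omega> 0 d2 0 {#} e r = Ham G (int d2 - 1) 0 {#} e r"
      unfolding at_p_zero_def by (rule fun_cong[of _ _ 0, THEN fun_cong, THEN fun_cong])
    with 0 Ham0[of d2] show ?case by simp
  next
    case (Suc d1)
    have "at_p_zero (deriv_p0 (\<Omega> (Suc d1) (Suc d2))) 0 e r =
        at_p_zero (\<Omega> (Suc d1 - 1) (Suc d2)) 0 e r + at_p_zero (\<Omega> (Suc d1) (Suc d2 - 1)) 0 e r"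
      using tp unfolding two_point_functions_def by simp
    then have rec: "\<Omega> (Suc d1) (Suc d2) 0 {#0#} e r = \<Omega> d1 (Suc d2) 0 {#} e r + \<Omega> (Suc d1) d2 0 {#} e r"
      by (simp add: at_p_zero_def deriv_p0_def)
    show ?case
    proof (cases "\<Omega> d1 (Suc d2) 0 {#} e r = 0")
      case False
      from Suc.IH[OF this] show ?thesis by (simp add: W_def)
    next
      case True
      with rec Suc.prems have "to_fourier (\<omega> (Suc d1) (Suc d2)) (sum_mset {#0#}) {#0#} e r \<noteq> 0"
        by (simp add: \<omega>(2))
      then have "(\<Sum>U | \<omega> (Suc d1) (Suc d2) U e r \<noteq> 0 \<and> size U = 1. \<omega> (Suc d1) (Suc d2) U e r * u_monom_coeff U {#0#}) \<noteq> 0"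
        by (subst (asm) to_fourier_homogeneous[OF \<omega>(1), where m = 1]) simp_all
      then obtain U where "U \<in> {U. \<omega> (Suc d1) (Suc d2) U e r \<noteq> 0 \<and> size U = 1}"
        by (rule sum.not_neutral_contains_not_neutral)
      then have U: "\<omega> (Suc d1) (Suc d2) U e r \<noteq> 0" "size U = 1" by auto
      then have "U \<noteq> {#}" by auto
      from pos[OF U(1) this] U(2) show ?thesis by (simp add: graded_at_def W_def)
    qed
  qed
  have "graded (W d1 d2) 0 1 (to_fourier (\<omega> d1 d2))"
  proof (rule graded_to_fourier[OF \<omega>(1)])
    fix U e r assume nz: "\<omega> d1 d2 U e r \<noteq> 0"
    show "graded_at (W d1 d2) 0 1 U e r"
    proof (cases "U = {#}")
      case True
      with nz have "\<Omega> d1 d2 0 {#} e r \<noteq> 0" by (simp add: \<omega> to_fourier_empty)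
      from const[OF this] True show ?thesis by (simp add: graded_at_def)
    qed (use pos nz in blast)
  qed
  then show ?thesis by (simp add: \<omega>(2) W_def)
qed

lemma graded_fold_flow:
  "graded w c s \<phi> \<Longrightarrow>
    graded (w + 2 * int (sum_list ks)) (c + length ks) ((- 1) ^ length ks * s) (fold (flow G) ks \<phi>)"
proof (induction ks arbitrary: w c s \<phi>)
  case (Cons k ks)
  have "graded (w + 2 * (int k + 2) - 4) (c + 0 + 1) (- (s * 1)) (flow G k \<phi>)"
    unfolding flow_def Ham_bar_def by (rule graded_commutator[OF Cons.prems graded_Ham]) simp
  from Cons.IH[OF this] show ?case by (simp add: algebra_simps)
qed simp

lemma graded_exp_flows:
  assumes "graded w c s \<phi>"
  shows "graded (w + 2 * int (sum_mset T)) (c + size T) ((- 1) ^ size T * s) (exp_flows G \<phi> T)"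
proof -
  have "graded (w + 2 * int (sum_mset T)) (c + size T) ((- 1) ^ size T * s) (fold (flow G) ks \<phi>)"
    if "mset ks = T" for ks
    using graded_fold_flow[OF assms, of ks]
    unfolding that[symmetric] by (simp only: sum_mset_sum_list size_mset)
  then have "graded (w + 2 * int (sum_mset T)) (c + size T) ((- 1) ^ size T * s)
      (\<lambda>A M e r. 1 / fact (size T) * (\<Sum>ks | mset ks = T. fold (flow G) ks \<phi> A M e r))"
    by (intro graded_scaled_sum) auto
  then show ?thesis by (simp add: exp_flows_def)
qed

text \<open>Two letters of T are spent on the second t-derivative, which is a flowed two-point
  function; only the other n - 2 act as flows, whence the excess n - 2.\<close>

lemma graded_potential:
  assumes tp: "two_point_functions G \<Omega>" and pot: "is_potential G \<Omega> F"
    and T: "size T = n" "n \<ge> 2" and nz: "F T U e r \<noteq> 0"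
  shows "graded_at (2 * (int (sum_mset T) + 1)) (n - 2) ((- 1) ^ n) U e r"
proof -
  obtain d1 T1 where T1: "T = add_mset d1 T1" using T by (cases T) auto
  then obtain d2 T' where T': "T = add_mset d2 (add_mset d1 T')" using T by (cases T1) (auto simp: add_mset_commute)
  let ?f = "deriv_t d1 (deriv_t d2 F) T'"
  define b :: complex where "b = of_nat (Suc (count T' d1)) * of_nat (Suc (count (add_mset d1 T') d2))"
  have b: "b \<noteq> 0" unfolding b_def by (simp del: of_nat_Suc)
  have f: "?f = (\<lambda>U e r. b * F T U e r)"
    by (simp add: deriv_t_def T' b_def fun_eq_iff mult.assoc)
  have "F T \<in> diff_polys" using pot by (simp add: is_potential_def)
  then have fd: "?f \<in> diff_polys" using b by (simp add: f diff_polys_def)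
  have "to_fourier ?f = exp_flows G (\<Omega> d1 d2) T'" using pot by (simp add: is_potential_def)
  with graded_exp_flows[OF graded_two_point_functions[OF tp, of d1 d2], of T']
  have gr: "graded (2 * (int d1 + int d2 + 1) + 2 * int (sum_mset T')) (0 + size T') ((- 1) ^ size T' * 1) (to_fourier ?f)"
    by simp
  have n: "n = size T' + 2" using T T' by simp
  have "?f U e r \<noteq> 0" using b nz by (simp add: f)
  from graded_at_of_to_fourier[OF fd gr this] show ?thesis
    by (simp add: n T' algebra_simps)
qed

end

lemma eval_u_nonzero:
  assumes "eval_u f e r \<noteq> 0"
  obtains m where "f (replicate_mset m 1) e r \<noteq> 0"
proof -
  from assms obtain U where "U \<in> {U. f U e r \<noteq> 0}" and nz: "f U e r * (\<Prod>s\<in>#U. if s = 1 then 1 else 0) \<noteq> 0"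
    unfolding eval_u_def by (rule sum.not_neutral_contains_not_neutral)
  have "(\<Prod>s\<in>#V. if s = 1 then 1 else 0) = (0::complex)" if "\<exists>s\<in>#V. s \<noteq> 1" for V :: "nat multiset"
    using that by (induction V) auto
  with nz have "\<forall>s\<in>#U. s = 1" by force
  then have "U = replicate_mset (size U) 1" by (induction U) auto
  with nz that show ?thesis by (metis mult_zero_left)
qed

lemma (in dr_geometry) eval_potential_zero:
  assumes tp: "two_point_functions G \<Omega>" and pot: "is_potential G \<Omega> F"
    and T: "size T = n" "n \<ge> 2" and "l \<le> g"
    and vanish: "int (sum_mset T) > 4 * int g - 3 + int n - int l \<or> [int (sum_mset T) = int n - int l] (mod 2)"
  shows "eval_u (F T) (2 * l) (g - l) = 0"
proof (rule ccontr)
  assume "eval_u (F T) (2 * l) (g - l) \<noteq> 0"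
  then obtain m where "F T (replicate_mset m 1) (2 * l) (g - l) \<noteq> 0" by (rule eval_u_nonzero)
  from graded_potential[OF tp pot T this]
  have w: "int (4 * (g - l) + 2 * l + 2 * m) = 2 * (int (sum_mset T) + 1)"
    and par: "(- 1 :: complex) ^ m = (- 1) ^ n" and deg: "m \<le> 2 * (g - l) + 2 * l + (n - 2)"
    by (simp_all add: graded_at_def)
  \<comment> \<open>With the degree bound m \<le> 2g + n - 2 this gives at most 4g - 3 + n - l for
    the sum of T; with m and n of equal parity, that sum minus n - l is odd.\<close>
  have m: "int m = int (sum_mset T) + 1 - 2 * int g + int l" using w \<open>l \<le> g\<close> by (simp add: of_nat_diff)
  have "int m \<le> 2 * int g + int n - 2" using deg \<open>l \<le> g\<close> \<open>n \<ge> 2\<close> by linarith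
  moreover have "even m \<longleftrightarrow> even n" using par by (cases "even m"; cases "even n") auto
  then have "even (int m - int n)" by simp
  ultimately show False using vanish m unfolding cong_iff_dvd_diff by presburger
qed

theorem proposition1p38:
  fixes G :: "'h::{comm_ring_1, real_algebra_1} moduli_data"
    and \<Omega> :: "nat \<Rightarrow> nat \<Rightarrow> fourier"
    and F :: "nat multiset \<Rightarrow> useries"
    and g n l :: nat
    and ds :: "nat list"
  assumes "dr_geometry G"
    and "two_point_functions G \<Omega>"
    and "is_potential G \<Omega> F"
    and "l \<le> g"
    and "length ds = n"
    and "int (sum_list ds) > 4 * int g - 3 + int n - int l \<or>
         [int (sum_list ds) = int n - int l] (mod 2)"
  shows "correlator F ds l (g - l) = 0"
proof -
  interpret dr_geometry G by fact
  note zero = eval_potential_zero[OF assms(2,3) _ _ assms(4)]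
  \<comment> \<open>One-point correlators are read off at \<open>t_0\<close> times the variable of
    index d + 1. The number of indices and their sum both grow by one, so the two conditions keep
    their form.\<close>
  have lin: "eval_u (F {#0, Suc d#}) (2 * l) (g - l) = 0"
    if "int d > 4 * int g - 2 - int l \<or> [int d = 1 - int l] (mod 2)" for d
  proof (rule zero[where n = 2])
    show "4 * int g - 3 + int 2 - int l < int (sum_mset {#0, Suc d#}) \<or> [int (sum_mset {#0, Suc d#}) = int 2 - int l] (mod 2)"
      using that by (auto simp: cong_iff_dvd_diff algebra_simps)
  qed simp_all
  have sum: "sum_mset (mset ds) = sum_list ds" by (rule sum_mset_sum_list)
  have "WK_series F (mset ds) (2 * l) (g - l) = 0"
  proof -
    consider "n \<ge> 2" | "n = 1" | "n = 0" by linarith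
    then show ?thesis
    proof cases
      case 1
      then show ?thesis using zero[of "mset ds" n] assms(5,6) sum by (simp add: WK_series_def)
    next
      case 2
      then obtain d where ds: "ds = [d]" using assms(5) by (auto simp: length_Suc_conv)
      then have "eval_u (F {#0, Suc d#}) (2 * l) (g - l) = 0"
        using assms(6) 2 by (intro lin) simp
      then show ?thesis by (simp add: WK_series_def ds)
    next
      case 3
      then have ds: "ds = []" using assms(5) by simp
      \<comment> \<open>The constant term is a multiple of the linear coefficient at index 1, or 0
        for g < 2. Going from no index to the single index 1 again raises number and sum by
        one.\<close>
      have "eval_u (F {#0, Suc 1#}) (2 * l) (g - l) = 0"
        using assms(6) 3 by (intro lin) (auto simp: ds cong_iff_dvd_diff)
      then show ?thesis by (simp add: WK_series_def ds Let_def)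
    qed
  qed
  then show ?thesis by (simp add: correlator_def)
qed

end
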